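(* For every real number $c\in(0,\infty)$ there exists a smooth $S^1$-invariant Riemannian metric $g$ on $S^2$ with total area $4\pi$ whose first invariant eigenvalue satisfies $\lambda_1(g)=c$. The same is true within the subclass of those metrics that have Gauss curvature equal to $1$ at the poles: for every $c\in(0,\infty)$ there exists a smooth $S^1$-invariant metric $g$ on $S^2$ with total area $4\pi$, with $K_g(N)=K_g(S)=1$, and with $\lambda_1(g)=c$.
   Context: $S^1$ acts on the unit sphere $S^2\subset\mathbb{R}^3$ by rotation about the vertical axis, fixing the North and South poles $N$ and $S$. A Riemannian metric $g$ on $S^2$ is $S^1$-invariant if this action is by isometries of $g$. For such $g$, let $\Delta_g$ be the (non-negative) Laplace operator of $g$ on functions. The invariant eigenvalues $0=\lambda_0(g)<\lambda_1(g)<\lambda_2(g)<\cdots$ are the eigenvalues of $\Delta_g$ restricted to $S^1$-invariant functions, i.e. the eigenvalues of $\Delta_g$ admitting a nonzero $S^1$-invariant eigenfunction. $K_g$ denotes the Gauss curvature of $g$. *)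

theory Defs
  imports "HOL-Analysis.Analysis"
begin

section \<open>Partial derivatives and smoothness in the plane\<close>

definition partial :: "2 \<Rightarrow> (real^2 \<Rightarrow> 'b::real_normed_vector) \<Rightarrow> real^2 \<Rightarrow> 'b" where
  "partial i f x = frechet_derivative f (at x) (axis i 1)"

primrec C_k :: "nat \<Rightarrow> (real^2 \<Rightarrow> real) \<Rightarrow> bool" where
  "C_k 0 f \<longleftrightarrow> continuous_on UNIV f"
| "C_k (Suc k) f \<longleftrightarrow> (\<forall>x. f differentiable (at x)) \<and> (\<forall>i. C_k k (partial i f))"

definition smooth :: "(real^2 \<Rightarrow> real) \<Rightarrow> bool" where
  "smooth f \<longleftrightarrow> (\<forall>k. C_k k f)"


section \<open>Riemannian geometry of a metric on the plane, in coordinates\<close>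

text \<open>A field \<open>h\<close> of symmetric positive definite matrices on the coordinate plane
  is regarded as the metric \<open>h\<^sub>i\<^sub>j dx\<^sup>i dx\<^sup>j\<close>.\<close>

definition gradient :: "(real^2 \<Rightarrow> real^2^2) \<Rightarrow> (real^2 \<Rightarrow> real) \<Rightarrow> real^2 \<Rightarrow> real^2" where
  "gradient h f x = matrix_inv (h x) *v (\<chi> j. partial j f x)"

definition divergence :: "(real^2 \<Rightarrow> real^2^2) \<Rightarrow> (real^2 \<Rightarrow> real^2) \<Rightarrow> real^2 \<Rightarrow> real" where
  "divergence h X x =
     (\<Sum>i\<in>UNIV. partial i (\<lambda>y. sqrt (det (h y)) * X y $ i) x) / sqrt (det (h x))"

definition coord_laplacian :: "(real^2 \<Rightarrow> real^2^2) \<Rightarrow> (real^2 \<Rightarrow> real) \<Rightarrow> real^2 \<Rightarrow> real" where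
  "coord_laplacian h f x = - divergence h (gradient h f) x"

text \<open>\<open>christoffel h k i j\<close> is \<open>\<Gamma>\<^sup>k\<^sub>i\<^sub>j\<close>, and
  \<open>riemann h l k i j\<close> is the \<open>l\<close>-th component of \<open>R(\<partial>\<^sub>i,\<partial>\<^sub>j)\<partial>\<^sub>k\<close>, where
  \<open>R(X,Y) = \<nabla>\<^sub>X\<nabla>\<^sub>Y - \<nabla>\<^sub>Y\<nabla>\<^sub>X - \<nabla>\<^sub>[\<^sub>X\<^sub>,\<^sub>Y\<^sub>]\<close>.\<close>

definition christoffel :: "(real^2 \<Rightarrow> real^2^2) \<Rightarrow> 2 \<Rightarrow> 2 \<Rightarrow> 2 \<Rightarrow> real^2 \<Rightarrow> real" where
  "christoffel h k i j x =
     (\<Sum>l\<in>UNIV. matrix_inv (h x) $ k $ l *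
        (partial i (\<lambda>y. h y $ j $ l) x + partial j (\<lambda>y. h y $ i $ l) x
          - partial l (\<lambda>y. h y $ i $ j) x)) / 2"

definition riemann :: "(real^2 \<Rightarrow> real^2^2) \<Rightarrow> 2 \<Rightarrow> 2 \<Rightarrow> 2 \<Rightarrow> 2 \<Rightarrow> real^2 \<Rightarrow> real" where
  "riemann h l k i j x =
     partial i (christoffel h l j k) x - partial j (christoffel h l i k) x
     + (\<Sum>m\<in>UNIV. christoffel h m j k x * christoffel h l i m x
                 - christoffel h m i k x * christoffel h l j m x)"

text \<open>\<open>K = \<langle>R(\<partial>\<^sub>1,\<partial>\<^sub>2)\<partial>\<^sub>2, \<partial>\<^sub>1\<rangle> / det h\<close>, which is \<open>+1\<close> for the round unit sphere.\<close>

definition coord_gauss_curvature :: "(real^2 \<Rightarrow> real^2^2) \<Rightarrow> real^2 \<Rightarrow> real" where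
  "coord_gauss_curvature h x =
     (\<Sum>l\<in>UNIV. riemann h l 2 1 2 x * h x $ l $ 1) / det (h x)"


section \<open>The sphere and its stereographic atlas\<close>

abbreviation S2 :: "(real^3) set" where
  "S2 \<equiv> sphere 0 1"

definition north :: "real^3" where "north = vector [0, 0, 1]"
definition south :: "real^3" where "south = vector [0, 0, -1]"

text \<open>For \<open>\<epsilon> = 1\<close> (resp. \<open>\<epsilon> = -1\<close>), \<open>stereo \<epsilon>\<close> is the inverse of the stereographic
  projection from the South (resp. North) pole, so that it is centred at the North
  (resp. South) pole; the two charts \<open>chart \<epsilon>\<close> form a smooth atlas of the sphere.\<close>

definition stereo :: "real \<Rightarrow> real^2 \<Rightarrow> real^3" where
  "stereo \<epsilon> x = (1 / (1 + (norm x)\<^sup>2)) *\<^sub>R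
     vector [2 * x $ 1, 2 * x $ 2, \<epsilon> * (1 - (norm x)\<^sup>2)]"

definition chart :: "real \<Rightarrow> real^3 \<Rightarrow> real^2" where
  "chart \<epsilon> p = (1 / (1 + \<epsilon> * p $ 3)) *\<^sub>R vector [p $ 1, p $ 2]"

lemma norm2_sq: "(norm (x :: real^2))\<^sup>2 = (x $ 1)\<^sup>2 + (x $ 2)\<^sup>2"
  by (simp add: norm_vec_def L2_set_def sum_2)

lemma norm3_sq: "(norm (p :: real^3))\<^sup>2 = (p $ 1)\<^sup>2 + (p $ 2)\<^sup>2 + (p $ 3)\<^sup>2"
  by (simp add: norm_vec_def L2_set_def sum_3)

lemma stereo_in_S2:
  assumes "\<epsilon> \<in> {1, -1}"
  shows "stereo \<epsilon> x \<in> S2"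
proof -
  define r where "r = (norm x)\<^sup>2"
  have r: "r \<ge> 0" "(x $ 1)\<^sup>2 + (x $ 2)\<^sup>2 = r"
    by (simp_all add: r_def norm2_sq)
  have e: "\<epsilon>\<^sup>2 = 1" using assms by auto
  have "(norm (stereo \<epsilon> x))\<^sup>2 = (4 * ((x $ 1)\<^sup>2 + (x $ 2)\<^sup>2) + \<epsilon>\<^sup>2 * (1 - r)\<^sup>2) / (1 + r)\<^sup>2"
    unfolding norm3_sq stereo_def r_def[symmetric]
    by (simp add: power_mult_distrib power_divide add_divide_distrib)
  also have "4 * ((x $ 1)\<^sup>2 + (x $ 2)\<^sup>2) + \<epsilon>\<^sup>2 * (1 - r)\<^sup>2 = (1 + r)\<^sup>2"
    unfolding e r(2) by (simp add: power2_eq_square algebra_simps)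
  finally have "(norm (stereo \<epsilon> x))\<^sup>2 = 1" using r by simp
  then have "norm (stereo \<epsilon> x) = 1"
    by (metis norm_ge_zero power2_eq_1_iff neg_0_le_iff_le not_one_le_zero)
  then show ?thesis by simp
qed

lemma chart_stereo:
  assumes "\<epsilon> \<in> {1, -1}"
  shows "chart \<epsilon> (stereo \<epsilon> x) = x"
proof -
  define r where "r = (norm x)\<^sup>2"
  have r: "r \<ge> 0" by (simp add: r_def)
  have e: "\<epsilon> * \<epsilon> = 1" using assms by auto
  have "1 + \<epsilon> * (stereo \<epsilon> x $ 3) = 1 + (\<epsilon> * \<epsilon>) * (1 - r) / (1 + r)"
    unfolding stereo_def r_def[symmetric] by simp
  also have "\<dots> = 2 / (1 + r)" unfolding e using r by (simp add: field_simps)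
  finally show ?thesis using r
    by (simp add: chart_def vec_eq_iff forall_2) (simp add: stereo_def r_def[symmetric])
qed

lemma stereo_chart:
  assumes "\<epsilon> \<in> {1, -1}" "p \<in> S2" "p \<noteq> vector [0, 0, -\<epsilon>]"
  shows "stereo \<epsilon> (chart \<epsilon> p) = p"
proof -
  have p: "(p $ 1)\<^sup>2 + (p $ 2)\<^sup>2 + (p $ 3)\<^sup>2 = 1"
    using assms(2) norm3_sq[of p] by simp
  define t where "t = \<epsilon> * p $ 3"
  have e: "\<epsilon> * \<epsilon> = 1" using assms(1) by auto
  have p3: "p $ 3 = \<epsilon> * t" using e by (simp add: t_def mult.assoc[symmetric])
  have t2: "(p $ 1)\<^sup>2 + (p $ 2)\<^sup>2 = (1 - t) * (1 + t)"
  proof -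
    have "(p $ 3)\<^sup>2 = t\<^sup>2"
      unfolding p3 using e by (simp add: power2_eq_square mult.assoc[symmetric] mult.commute)
    then show ?thesis using p by (simp add: power2_eq_square algebra_simps)
  qed
  have t: "1 + t \<noteq> 0"
  proof
    assume "1 + t = 0"
    then have "t = -1" "(p $ 1)\<^sup>2 + (p $ 2)\<^sup>2 = 0" using t2 by simp_all
    then have "p = vector [0, 0, -\<epsilon>]"
      using p3 by (simp add: vec_eq_iff forall_3 sum_power2_eq_zero_iff)
    then show False using assms(3) by simp
  qed
  have "(norm (chart \<epsilon> p))\<^sup>2 = ((p $ 1)\<^sup>2 + (p $ 2)\<^sup>2) / (1 + t)\<^sup>2"
    unfolding norm2_sq chart_def t_def[symmetric]
    by (simp add: power_divide add_divide_distrib)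
  then have n: "(norm (chart \<epsilon> p))\<^sup>2 = (1 - t) / (1 + t)"
    unfolding t2 using t by (simp add: power2_eq_square)
  have a: "1 + (1 - t) / (1 + t) = 2 / (1 + t)"
    and b: "1 - (1 - t) / (1 + t) = 2 * t / (1 + t)"
    using t by (simp_all add: field_simps)
  have ch: "chart \<epsilon> p = (1 / (1 + t)) *\<^sub>R vector [p $ 1, p $ 2]"
    by (simp add: chart_def t_def)
  show ?thesis
    unfolding stereo_def n a b unfolding ch using t
    by (simp add: vec_eq_iff forall_3 p3)
qed

definition smooth_on_S2 :: "(real^3 \<Rightarrow> real) \<Rightarrow> bool" where
  "smooth_on_S2 f \<longleftrightarrow> (\<forall>\<epsilon>\<in>{1, -1}. smooth (\<lambda>x. f (stereo \<epsilon> x)))"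


section \<open>Riemannian metrics on the sphere\<close>

definition tangent_space :: "real^3 \<Rightarrow> (real^3) set" where
  "tangent_space p = {v. p \<bullet> v = 0}"

text \<open>\<open>g p u v\<close> is the inner product of \<open>u\<close> and \<open>v\<close> in the tangent space at \<open>p\<close>;
  its values for other arguments are irrelevant.\<close>

type_synonym metric = "real^3 \<Rightarrow> real^3 \<Rightarrow> real^3 \<Rightarrow> real"

definition pullback :: "metric \<Rightarrow> real \<Rightarrow> real^2 \<Rightarrow> real^2^2" where
  "pullback g \<epsilon> x =
     (\<chi> i j. g (stereo \<epsilon> x) (partial i (stereo \<epsilon>) x) (partial j (stereo \<epsilon>) x))"

definition riemannian_metric :: "metric \<Rightarrow> bool" where
  "riemannian_metric g \<longleftrightarrow>
     (\<forall>p\<in>S2.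
        (\<forall>u\<in>tangent_space p. \<forall>v\<in>tangent_space p. \<forall>w\<in>tangent_space p. \<forall>a b.
            g p (a *\<^sub>R u + b *\<^sub>R v) w = a * g p u w + b * g p v w) \<and>
        (\<forall>u\<in>tangent_space p. \<forall>v\<in>tangent_space p. g p u v = g p v u) \<and>
        (\<forall>u\<in>tangent_space p. u \<noteq> 0 \<longrightarrow> g p u u > 0)) \<and>
     (\<forall>\<epsilon>\<in>{1, -1}. \<forall>i j. smooth (\<lambda>x. pullback g \<epsilon> x $ i $ j))"

text \<open>The Laplacian and the curvature at \<open>p\<close> do not depend on the chart around \<open>p\<close> in
  which they are computed; we use the one centred at the pole of the hemisphere of \<open>p\<close>.\<close>

definition hemisphere :: "real^3 \<Rightarrow> real" where
  "hemisphere p = (if p $ 3 \<ge> 0 then 1 else -1)"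

definition laplacian :: "metric \<Rightarrow> (real^3 \<Rightarrow> real) \<Rightarrow> real^3 \<Rightarrow> real" where
  "laplacian g f p =
     (let \<epsilon> = hemisphere p
      in coord_laplacian (pullback g \<epsilon>) (\<lambda>x. f (stereo \<epsilon> x)) (chart \<epsilon> p))"

definition gauss_curvature :: "metric \<Rightarrow> real^3 \<Rightarrow> real" where
  "gauss_curvature g p =
     (let \<epsilon> = hemisphere p in coord_gauss_curvature (pullback g \<epsilon>) (chart \<epsilon> p))"

text \<open>A single stereographic chart suffices for the area, as it misses only one point.\<close>

definition has_area :: "metric \<Rightarrow> real \<Rightarrow> bool" where
  "has_area g A \<longleftrightarrow>
     has_bochner_integral lborel (\<lambda>x. sqrt (det (pullback g 1 x))) A"


section \<open>Rotational invariance and invariant eigenvalues\<close>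

definition rotate :: "real \<Rightarrow> real^3 \<Rightarrow> real^3" where
  "rotate \<theta> p = vector [cos \<theta> * p $ 1 - sin \<theta> * p $ 2, sin \<theta> * p $ 1 + cos \<theta> * p $ 2, p $ 3]"

text \<open>Since \<open>rotate \<theta>\<close> is linear, it is its own differential.\<close>

definition S1_invariant_metric :: "metric \<Rightarrow> bool" where
  "S1_invariant_metric g \<longleftrightarrow> riemannian_metric g \<and>
     (\<forall>\<theta>. \<forall>p\<in>S2. \<forall>u\<in>tangent_space p. \<forall>v\<in>tangent_space p.
        g (rotate \<theta> p) (rotate \<theta> u) (rotate \<theta> v) = g p u v)"

definition S1_invariant_fun :: "(real^3 \<Rightarrow> real) \<Rightarrow> bool" where
  "S1_invariant_fun f \<longleftrightarrow> (\<forall>\<theta>. \<forall>p\<in>S2. f (rotate \<theta> p) = f p)"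

definition invariant_spectrum :: "metric \<Rightarrow> real set" where
  "invariant_spectrum g =
     {\<mu>. \<exists>f. smooth_on_S2 f \<and> S1_invariant_fun f \<and> (\<exists>p\<in>S2. f p \<noteq> 0) \<and>
          (\<forall>p\<in>S2. laplacian g f p = \<mu> * f p)}"

text \<open>\<open>invariant_eigenvalue g k \<mu>\<close> says that \<open>\<lambda>\<^sub>k(g) = \<mu>\<close> in the strictly increasing
  enumeration \<open>\<lambda>\<^sub>0(g) < \<lambda>\<^sub>1(g) < \<dots>\<close> of the invariant spectrum, counted from \<open>0\<close>.\<close>

definition invariant_eigenvalue :: "metric \<Rightarrow> nat \<Rightarrow> real \<Rightarrow> bool" where
  "invariant_eigenvalue g k \<mu> \<longleftrightarrow>
     \<mu> \<in> invariant_spectrum g \<and>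
     finite {\<nu> \<in> invariant_spectrum g. \<nu> < \<mu>} \<and>
     card {\<nu> \<in> invariant_spectrum g. \<nu> < \<mu>} = k"

lemma invariant_eigenvalue_unique:
  assumes "invariant_eigenvalue g k \<mu>" "invariant_eigenvalue g k \<mu>'"
  shows "\<mu> = \<mu>'"
proof -
  have less: False
    if "invariant_eigenvalue g k a" "invariant_eigenvalue g k b" "a < b" for a b
  proof -
    have "{\<nu> \<in> invariant_spectrum g. \<nu> < a} \<subset> {\<nu> \<in> invariant_spectrum g. \<nu> < b}"
      using that by (auto simp: invariant_eigenvalue_def psubset_eq intro: less_trans)
    then show False
      using psubset_card_mono that unfolding invariant_eigenvalue_def by (metis less_irrefl)
  qed
  show ?thesis using less[OF assms] less[OF assms(2,1)] by (meson linorder_neqE)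
qed

end

theory Submission
  imports Defs "HOL-Computational_Algebra.Polynomial"
begin

text \<open>
  In the coordinates \<open>(z, \<theta>)\<close>, where \<open>z\<close> is the height, a metric
  \<open>dz\<^sup>2 / \<phi> + \<phi> d\<theta>\<^sup>2\<close> has the area form of the round sphere, hence area \<open>4\<pi>\<close>, and its
  Laplacian acts on functions of \<open>z\<close> as \<open>u \<mapsto> - (\<phi> u')'\<close>. So one can prescribe an
  increasing polynomial \<open>u\<close> of mean zero and solve \<open>(\<phi> u')' = - c u\<close> for \<open>\<phi>\<close>: the flux
  \<open>F = \<phi> u'\<close> is the primitive of \<open>- c u\<close> vanishing at both poles, and \<open>\<phi> = F / u'\<close>.
  Smoothness at the poles fixes \<open>u'(1) / u(1)\<close> and curvature \<open>1\<close> fixes \<open>u''(1) / u'(1)\<close>;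
  the family \<open>u' = z\<^sup>2\<^sup>n (1 + m (1 - z\<^sup>2)) + \<delta> (1 - z\<^sup>2)\<^sup>2\<close> achieves both for every \<open>c > 0\<close>.
  No eigenvalue \<open>\<nu> < c\<close> other than \<open>0\<close> exists, because \<open>F > 0\<close>: if \<open>v\<close> is an eigenfunction
  for \<open>\<nu>\<close> and \<open>h = v' / u'\<close>, then \<open>(F\<^sup>2 h h')' = (F h')\<^sup>2 + (c - \<nu>) F u' h\<^sup>2 \<ge> 0\<close>, while
  \<open>F\<^sup>2 h h'\<close> vanishes at both poles, which forces \<open>h = 0\<close>.
\<close>

section \<open>Smooth functions of two variables\<close>

lemma partial_eq:
  "(f has_derivative f') (at x) \<Longrightarrow> partial i f x = f' (axis i 1)"
  unfolding partial_def by (simp add: frechet_derivative_at[symmetric])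

lemma C_k_continuous_on: "C_k k f \<Longrightarrow> continuous_on UNIV f"
  by (cases k) (auto simp: continuous_on_eq_continuous_at intro: differentiable_imp_continuous_within)

lemma C_k_Suc_imp: "C_k (Suc k) f \<Longrightarrow> C_k k f"
  by (induction k arbitrary: f) (use C_k_continuous_on[of "Suc 0"] in auto)

lemma C_k_const: "C_k k (\<lambda>x. a)"
proof (induction k arbitrary: a)
  case (Suc k)
  have "partial i (\<lambda>x. a) = (\<lambda>x. 0)" for i by (rule ext) (simp add: partial_eq[OF has_derivative_const])
  with Suc show ?case by simp
qed simp

lemma C_k_component: "C_k k (\<lambda>x. x $ j)"
proof (cases k)
  case 0
  then show ?thesis by (simp add: continuous_on_component)
next
  case (Suc k)
  have d: "((\<lambda>x::real^2. x $ j) has_derivative (\<lambda>d. d $ j)) (at x)" for x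
    by (intro bounded_linear_imp_has_derivative bounded_linear_vec_nth)
  then have "partial i (\<lambda>x. x $ j) = (\<lambda>x. axis i 1 $ j)" for i by (intro ext partial_eq)
  with d Suc show ?thesis by (auto simp: C_k_const differentiable_def)
qed

lemma C_k_add: "C_k k f \<Longrightarrow> C_k k g \<Longrightarrow> C_k k (\<lambda>x. f x + g x)"
proof (induction k arbitrary: f g)
  case (Suc k)
  have "partial i (\<lambda>x. f x + g x) = (\<lambda>x. partial i f x + partial i g x)" for i
  proof
    fix x
    obtain f' g' where d: "(f has_derivative f') (at x)" "(g has_derivative g') (at x)"
      using Suc.prems unfolding C_k.simps differentiable_def by blast
    show "partial i (\<lambda>x. f x + g x) x = partial i f x + partial i g x"
      using partial_eq[OF d(1)] partial_eq[OF d(2)] partial_eq[OF has_derivative_add[OF d]] by simp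
  qed
  with Suc show ?case by (auto intro: differentiable_add)
qed (auto intro: continuous_on_add)

lemma C_k_mult: "C_k k f \<Longrightarrow> C_k k g \<Longrightarrow> C_k k (\<lambda>x. f x * g x)"
proof (induction k arbitrary: f g)
  case (Suc k)
  have "partial i (\<lambda>x. f x * g x) = (\<lambda>x. f x * partial i g x + partial i f x * g x)" for i
  proof
    fix x
    obtain f' g' where d: "(f has_derivative f') (at x)" "(g has_derivative g') (at x)"
      using Suc.prems unfolding C_k.simps differentiable_def by blast
    show "partial i (\<lambda>x. f x * g x) x = f x * partial i g x + partial i f x * g x"
      using partial_eq[OF d(1)] partial_eq[OF d(2)] partial_eq[OF has_derivative_mult[OF d]] by simp
  qed
  with Suc C_k_Suc_imp[OF Suc.prems(1)] C_k_Suc_imp[OF Suc.prems(2)] show ?case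
    by (auto intro!: differentiable_mult C_k_add)
qed (auto intro: continuous_on_mult)

text \<open>The partials of 1/f are products of 1/f twice and a partial of f, so order
  \<open>k\<close> for 1/f feeds order \<open>Suc k\<close>.\<close>

lemma C_k_inverse:
  assumes "\<And>x. f x \<noteq> 0"
  shows "C_k k f \<Longrightarrow> C_k k (\<lambda>x. inverse (f x))"
proof (induction k)
  case 0
  with assms show ?case by (auto intro!: continuous_on_inverse)
next
  case (Suc k)
  have d: "((\<lambda>x. inverse (f x)) has_derivative (\<lambda>h. - (inverse (f x) * f' h * inverse (f x)))) (at x)"
    if "(f has_derivative f') (at x)" for f' x
    by (rule Deriv.has_derivative_inverse[OF assms that])
  \<comment> \<open>The sign is written as a constant factor so that closure under products and
    constants suffices.\<close>
  have "partial i (\<lambda>x. inverse (f x)) = (\<lambda>x. (-1) * (inverse (f x) * partial i f x * inverse (f x)))" for i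
  proof
    fix x
    obtain f' where f': "(f has_derivative f') (at x)"
      using Suc.prems by (auto simp: differentiable_def)
    show "partial i (\<lambda>x. inverse (f x)) x = (-1) * (inverse (f x) * partial i f x * inverse (f x))"
      using partial_eq[OF f'] partial_eq[OF d[OF f']] by simp
  qed
  moreover have "C_k k (\<lambda>x. inverse (f x))" using Suc C_k_Suc_imp by blast
  moreover have "(\<lambda>x. inverse (f x)) differentiable (at x)" for x
    using Suc.prems d by (fastforce simp: differentiable_def)
  moreover have "C_k k (partial i f)" for i using Suc.prems by simp
  ultimately show ?case
    unfolding C_k.simps by (simp only:) (intro conjI allI C_k_mult C_k_const TrueI; assumption)
qed

section \<open>Closure rules for infinitely differentiable functions\<close>

named_theorems smooth_intros

lemma smooth_const [smooth_intros]: "smooth (\<lambda>x. a)"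
  and smooth_component [smooth_intros]: "smooth (\<lambda>x. x $ j)"
  by (simp_all add: smooth_def C_k_const C_k_component)

lemma smooth_add [smooth_intros]: "smooth f \<Longrightarrow> smooth g \<Longrightarrow> smooth (\<lambda>x. f x + g x)"
  and smooth_mult [smooth_intros]: "smooth f \<Longrightarrow> smooth g \<Longrightarrow> smooth (\<lambda>x. f x * g x)"
  by (simp_all add: smooth_def C_k_add C_k_mult)

lemma smooth_diff [smooth_intros]:
  assumes "smooth f" "smooth g" shows "smooth (\<lambda>x. f x - g x)"
  using smooth_add[OF assms(1) smooth_mult[OF smooth_const[of "-1"] assms(2)]] by simp

lemma smooth_divide [smooth_intros]:
  assumes "smooth f" "smooth g" "\<And>x. g x \<noteq> 0" shows "smooth (\<lambda>x. f x / g x)"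
  using assms unfolding divide_inverse by (intro smooth_mult) (auto simp: smooth_def C_k_inverse)

lemma smooth_power [smooth_intros]: "smooth f \<Longrightarrow> smooth (\<lambda>x. f x ^ n)"
  by (induction n) (auto intro: smooth_intros)

lemma smooth_poly [smooth_intros]: "smooth f \<Longrightarrow> smooth (\<lambda>x. poly p (f x))"
  by (induction p) (auto intro: smooth_intros)

lemma smooth_differentiable: "smooth f \<Longrightarrow> f differentiable (at x)"
  unfolding smooth_def by (metis C_k.simps(2))

lemma smooth_partial: "smooth f \<Longrightarrow> smooth (partial i f)"
  unfolding smooth_def by (metis C_k.simps(2))

lemma smooth_isCont: "smooth f \<Longrightarrow> isCont f x"
  using smooth_differentiable differentiable_imp_continuous_within by blast

section \<open>The polynomial profiles\<close>

lemma dvd_one_minus_square: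
  fixes p :: "real poly"
  assumes "poly p 1 = 0" "poly p (-1) = 0"
  obtains q where "p = [:1, 0, -1:] * q"
proof -
  obtain a where a: "p = [:-1, 1:] * a"
    using assms(1) by (auto simp: poly_eq_0_iff_dvd dvd_def)
  with assms(2) have "poly a (-1) = 0" by simp
  then obtain b where b: "a = [:1, 1:] * b"
    using poly_eq_0_iff_dvd[of a "-1"] by (auto simp: dvd_def)
  \<comment> \<open>(z - 1)(z + 1) is -(1 - z^2), hence the minus sign on the cofactor.\<close>
  have "p = [:1, 0, -1:] * (-b)"
    unfolding a b mult.assoc[symmetric] by simp
  then show ?thesis using that by blast
qed

text \<open>Each parameter has one task: \<open>m\<close> sets the slope of \<open>Q\<close> at the
  poles (curvature), \<open>\<delta>\<close> sets the value of \<open>U\<close> there (smoothness),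
  and a large \<open>n\<close> leaves room for both \<open>m\<close> and \<open>\<delta>\<close> to
  have the right sign.\<close>

lemma eigenfunction_polynomials:
  fixes c :: real
  assumes c: "c > 0"
  obtains Q G H U :: "real poly" where
    "\<And>z. \<bar>z\<bar> \<le> 1 \<Longrightarrow> poly Q z > 0"
    "\<And>z. \<bar>z\<bar> \<le> 1 \<Longrightarrow> poly G z > 0"
    "Q = G + [:1, 0, -1:] * H"
    "poly H 1 = 0" "poly H (-1) = 0"
    "pderiv U = Q"
    "pderiv ([:1, 0, -1:] * G) = smult (-c) U"
proof -
  obtain n :: nat where n: "real n > c" using reals_Archimedean2 by blast
  \<comment> \<open>Write F = (1 - z^2) G. At z = 1, F'' = -c Q with Q(1) = G(1) = 1 forces G'(1) =
    (c - 2)/4 = 2 k. Matching Q'(1) = 2 n - 2 m to this value gives m = n - k.\<close>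
  define k where "k = (c - 2) / 8"
  define m where "m = n - k"
  have m: "m \<ge> 0" "m \<le> n + 1" using c n by (auto simp: m_def k_def)
  \<comment> \<open>The integral of z^(2n) (1 + m (1 - z^2)) over [0, 1]; it has to stay below 2/c
    to leave a positive remainder for the \<open>\<delta>\<close> term.\<close>
  define base where "base = (1 + m) / (2 * n + 1) - m / (2 * n + 3)"
  have "base = (1 + 2 * m / (2 * n + 3)) / (2 * n + 1)"
    unfolding base_def by (simp add: divide_simps) (simp add: algebra_simps)
  also have "\<dots> \<le> 2 / (2 * n + 1)"
    using m by (intro divide_right_mono) (auto simp: divide_simps)
  also have "\<dots> < 2 / c" using c n by (intro divide_strict_left_mono) auto
  finally have base: "base < 2 / c" .
  \<comment> \<open>Since (1 - z^2)^2 has integral 8/15 over [0, 1], this choice yields U(1) = 2/c.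
    That value is needed because -c U(1) = F'(1) = -2 G(1) and G(1) is to be 1.\<close>
  define \<delta> where "\<delta> = 15 / 8 * (2 / c - base)"
  have \<delta>: "\<delta> > 0" using base by (simp add: \<delta>_def)
  define Q :: "real poly" where
    "Q = monom (1 + m) (2 * n) - monom m (2 * n + 2) + smult \<delta> [:1, 0, -2, 0, 1:]"
  define U :: "real poly" where
    "U = monom ((1 + m) / (2 * n + 1)) (2 * n + 1) - monom (m / (2 * n + 3)) (2 * n + 3)
       + smult \<delta> [:0, 1, 0, -2/3, 0, 1/5:]"
  \<comment> \<open>\<open>U\<close> is the odd primitive of \<open>Q\<close>, and \<open>F0\<close>
    an even primitive of \<open>U\<close>. Evenness lets a single constant make \<open>F\<close>
    vanish at both poles.\<close>
  define F0 :: "real poly" where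
    "F0 = monom ((1 + m) / ((2 * real n + 1) * (2 * real n + 2))) (2 * n + 2)
       - monom (m / ((2 * real n + 3) * (2 * real n + 4))) (2 * n + 4)
       + smult \<delta> [:0, 0, 1/2, 0, -1/6, 0, 1/30:]"
  define F where "F = smult c ([:poly F0 1:] - F0)"
  have Qz: "poly Q z = z ^ (2 * n) * (1 + m * (1 - z\<^sup>2)) + \<delta> * (1 - z\<^sup>2)\<^sup>2" for z
    by (simp add: Q_def poly_monom algebra_simps power2_eq_square)
  \<comment> \<open>Where z^2 = 1 the first summand is 1; elsewhere the \<open>\<delta>\<close>
    summand is positive, which covers the zero of z^(2n) at the equator.\<close>
  have Qpos: "poly Q z > 0" if "\<bar>z\<bar> \<le> 1" for z
  proof -
    have z: "z\<^sup>2 \<le> 1" using that by (simp add: abs_square_le_1)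
    then have a: "1 + m * (1 - z\<^sup>2) > 0"
      using m(1) by (intro add_pos_nonneg mult_nonneg_nonneg) auto
    show ?thesis
    proof (cases "z\<^sup>2 = 1")
      case True
      then show ?thesis by (simp add: Qz power_mult)
    next
      case False
      then have "\<delta> * (1 - z\<^sup>2)\<^sup>2 > 0" using \<delta> by auto
      moreover have "z ^ (2 * n) * (1 + m * (1 - z\<^sup>2)) \<ge> 0" using a by (simp add: power_mult)
      ultimately show ?thesis unfolding Qz by linarith
    qed
  qed
  have dU: "pderiv U = Q"
  proof -
    have "(1 + m) / (2 * n + 1) * (2 * n + 1) = 1 + m" "m / (2 * n + 3) * (2 * n + 3) = m"
      by (simp_all add: divide_simps)
    then show ?thesis
      unfolding U_def Q_def
      by (simp add: pderiv_add pderiv_diff pderiv_smult pderiv_monom pderiv_pCons mult.commute numeral_eq_Suc)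
  qed
  have dF0: "pderiv F0 = U"
  proof -
    have "(1 + m) * (2 * real n + 2) / ((2 * real n + 1) * (2 * real n + 2)) = (1 + m) / (2 * real n + 1)"
         "m * (2 * real n + 4) / ((2 * real n + 3) * (2 * real n + 4)) = m / (2 * real n + 3)"
      by (rule nonzero_mult_divide_mult_cancel_right, simp)+
    then show ?thesis
      unfolding U_def F0_def
      by (simp add: pderiv_add pderiv_diff pderiv_smult pderiv_monom pderiv_pCons numeral_eq_Suc algebra_simps)
  qed
  have dF: "pderiv F = smult (-c) U"
    by (simp add: F_def pderiv_smult pderiv_diff dF0 pderiv_pCons)
  have F1: "poly F 1 = 0" by (simp add: F_def)
  have F1': "poly F (-1) = 0" by (simp add: F_def F0_def poly_monom)
  obtain G where G: "F = [:1, 0, -1:] * G" using dvd_one_minus_square[OF F1 F1'] .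
  have U1: "poly U 1 = 2 / c"
  proof -
    have "poly U 1 = base + \<delta> * (8 / 15)" by (simp add: U_def poly_monom base_def)
    then show ?thesis by (simp add: \<delta>_def field_simps)
  qed
  have U1': "poly U (-1) = - (2 / c)"
    unfolding U1[symmetric] by (simp add: U_def poly_monom)
  have dsq: "pderiv [:1, 0, - 1:] = [:0, - 2 :: real:]" "pderiv [:0, - 2:] = [:- 2 :: real:]"
    by (simp_all add: pderiv_pCons)
  have dFG: "poly (pderiv F) z = (1 - z\<^sup>2) * poly (pderiv G) z - 2 * z * poly G z" for z
    unfolding G pderiv_mult dsq by (simp add: algebra_simps power2_eq_square)
  have G1: "poly G 1 = 1" "poly G (-1) = 1"
    using dFG[of 1] dFG[of "-1"] c by (simp_all add: dF U1 U1')
  have Q1: "poly Q 1 = 1" "poly Q (-1) = 1" by (simp_all add: Qz power_mult)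
  obtain H where H: "Q - G = [:1, 0, -1:] * H"
    using dvd_one_minus_square[of "Q - G"] G1 Q1 by auto
  have dQ1: "poly (pderiv Q) 1 = 2 * k" "poly (pderiv Q) (-1) = - 2 * k"
    by (simp_all add: Q_def pderiv_add pderiv_diff pderiv_smult pderiv_monom pderiv_pCons poly_monom
        m_def algebra_simps)
      (cases n; simp add: algebra_simps)
  have ddFG: "- c * poly Q z = (1 - z\<^sup>2) * poly (pderiv (pderiv G)) z
      - 4 * z * poly (pderiv G) z - 2 * poly G z" for z
  proof -
    have "poly (pderiv (pderiv F)) z = - c * poly Q z"
      unfolding dF pderiv_smult dU by simp
    then show ?thesis
      unfolding G pderiv_mult pderiv_add dsq by (simp add: algebra_simps power2_eq_square)
  qed
  have dG1: "poly (pderiv G) 1 = 2 * k" "poly (pderiv G) (-1) = - 2 * k"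
    using ddFG[of 1] ddFG[of "-1"] by (simp_all add: Q1 G1 k_def)
  have dH: "poly (pderiv Q) z - poly (pderiv G) z = (1 - z\<^sup>2) * poly (pderiv H) z - 2 * z * poly H z" for z
    using arg_cong[OF H, of "\<lambda>p. poly (pderiv p) z"]
    unfolding pderiv_mult pderiv_diff dsq by (simp add: algebra_simps power2_eq_square)
  \<comment> \<open>At z = 1 and z = -1, \<open>dH\<close> reduces to Q' - G' = -2 z H, so equal
    slopes of \<open>Q\<close> and \<open>G\<close> at the poles make \<open>H\<close> vanish
    there.\<close>
  have H1: "poly H 1 = 0" "poly H (-1) = 0"
    using dH[of 1] dH[of "-1"] dQ1 dG1 by simp_all
  have U0: "poly U 0 = 0" by (simp add: U_def poly_monom)
  have Upos: "poly U z > 0" if "0 < z" "z \<le> 1" for z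
    using poly_MVT[OF that(1), of U] that Qpos U0 by (auto simp: dU)
  have Uneg: "poly U z < 0" if z: "z < 0" "-1 \<le> z" for z
  proof -
    obtain x where x: "z < x" "x < 0" "poly U 0 - poly U z = - z * poly Q x"
      using poly_MVT[OF z(1), of U] by (auto simp: dU)
    moreover have "poly Q x > 0" using Qpos x z by simp
    ultimately show ?thesis using U0 z mult_pos_pos[of "-z" "poly Q x"] by simp
  qed
  \<comment> \<open>F' = -c U has the sign opposite to z, so \<open>F\<close> decreases to its zero
    at the pole on the side of z; the mean value theorem is applied towards that pole.\<close>
  have Fpos: "poly F z > 0" if z: "\<bar>z\<bar> < 1" for z
  proof (cases "z \<ge> 0")
    case True
    obtain x where x: "z < x" "x < 1" "poly F 1 - poly F z = (1 - z) * poly (pderiv F) x"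
      using poly_MVT[of z 1 F] z by (auto simp: abs_less_iff)
    have "poly U x > 0" using x(1,2) True by (intro Upos) auto
    then have "(1 - z) * (c * poly U x) > 0" using z c by (intro mult_pos_pos) auto
    then show ?thesis using x(3) F1 by (simp add: dF)
  next
    case False
    obtain x where x: "-1 < x" "x < z" "poly F z - poly F (-1) = (z + 1) * poly (pderiv F) x"
      using poly_MVT[of "-1" z F] z by (auto simp: abs_less_iff)
    have "poly U x < 0" using x(1,2) False by (intro Uneg) auto
    then have "(z + 1) * (c * - poly U x) > 0" using z c by (intro mult_pos_pos) auto
    then show ?thesis using x(3) F1' by (simp add: dF)
  qed
  have Gpos: "poly G z > 0" if z: "\<bar>z\<bar> \<le> 1" for z
  proof (cases "\<bar>z\<bar> = 1")
    case True
    then have "z = 1 \<or> z = -1" by auto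
    then show ?thesis using G1 by auto
  next
    case False
    then have "\<bar>z\<bar> < 1" using z by simp
    moreover from this have "1 - z\<^sup>2 > 0" by (simp add: abs_square_less_1)
    moreover have "poly F z = (1 - z\<^sup>2) * poly G z"
      unfolding G by (simp add: algebra_simps power2_eq_square)
    ultimately show ?thesis using Fpos zero_less_mult_pos by metis
  qed
  show ?thesis
    using that[OF Qpos Gpos _ H1 dU] H dF unfolding G by (simp add: algebra_simps)
qed

section \<open>Area of the round sphere in stereographic coordinates\<close>

text \<open>Layer-cake computation, starting from \<open>1 / (1 + r)\<^sup>2 = \<integral>\<^sub>r\<^sup>\<infinity> 2 / (1 + t)\<^sup>3 dt\<close>.\<close>

lemma has_bochner_integral_round_area:
  "has_bochner_integral lborel (\<lambda>x::real^2. 4 / (1 + (norm x)\<^sup>2)\<^sup>2) (4 * pi)"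
proof (rule has_bochner_integral_nn_integral)
  \<comment> \<open>The absolute value keeps \<open>f\<close> nonnegative on the whole line; only t
    \<ge> 0 contributes to the integral.\<close>
  define f :: "real \<Rightarrow> real" where "f t = 8 / (1 + \<bar>t\<bar>) ^ 3" for t
  have f [measurable]: "f \<in> borel_measurable borel" unfolding f_def by measurable
  have d: "((\<lambda>t. k / (1 + t)\<^sup>2) has_real_derivative - 2 * k / (1 + t) ^ 3) (at t)"
      "((\<lambda>t. k / (1 + t)) has_real_derivative - k / (1 + t)\<^sup>2) (at t)" if "t \<ge> 0" for k t :: real
  proof -
    have "2 * k * a / (a\<^sup>2)\<^sup>2 = 2 * k / a ^ 3" if "a \<noteq> 0" for a :: real
      using that by (simp add: field_simps power3_eq_cube power2_eq_square)
    moreover have "2 * k * (1 + t) = k * (2 + 2 * t)" by (simp add: algebra_simps)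
    ultimately have "k * (2 + 2 * t) / ((1 + t)\<^sup>2)\<^sup>2 = 2 * k / (1 + t) ^ 3" using that by (metis add_nonneg_pos less_irrefl add.commute zero_less_one)
    then show "((\<lambda>t. k / (1 + t)\<^sup>2) has_real_derivative - 2 * k / (1 + t) ^ 3) (at t)"
      using that by (auto intro!: derivative_eq_intros)
    show "((\<lambda>t. k / (1 + t)) has_real_derivative - k / (1 + t)\<^sup>2) (at t)"
      using that by (auto intro!: derivative_eq_intros simp: power2_eq_square)
  qed
  have lim: "LIM t at_top. 1 + t :: real :> at_top"
    by (rule filterlim_tendsto_add_at_top[OF tendsto_const filterlim_ident])
  have "(\<integral>\<^sup>+ (x::real^2). ennreal (4 / (1 + (norm x)\<^sup>2)\<^sup>2) \<partial>lborel)
      = (\<integral>\<^sup>+ (x::real^2). \<integral>\<^sup>+ t. ennreal (f t) * indicator {(norm x)\<^sup>2..} t \<partial>lborel \<partial>lborel)"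
  proof (intro nn_integral_cong)
    fix x :: "real^2"
    have "(\<integral>\<^sup>+ t. ennreal (f t) * indicator {(norm x)\<^sup>2..} t \<partial>lborel)
        = ennreal (0 - - 4 / (1 + (norm x)\<^sup>2)\<^sup>2)"
    proof (rule nn_integral_FTC_atLeast[where F = "\<lambda>t. - 4 / (1 + t)\<^sup>2"])
      fix t :: real assume "(norm x)\<^sup>2 \<le> t"
      then have t: "t \<ge> 0" by (meson order_trans zero_le_power2)
      then show "((\<lambda>t. - 4 / (1 + t)\<^sup>2) has_real_derivative f t) (at t)"
        using d[of t "-4"] by (simp add: f_def)
      show "0 \<le> f t" by (simp add: f_def)
    next
      show "((\<lambda>t::real. - 4 / (1 + t)\<^sup>2) \<longlongrightarrow> 0) at_top"
        by (intro tendsto_divide_0[OF tendsto_const] filterlim_at_top_imp_at_infinity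
            filterlim_pow_at_top lim) simp
    qed (rule f)
    then show "ennreal (4 / (1 + (norm x)\<^sup>2)\<^sup>2)
        = (\<integral>\<^sup>+ t. ennreal (f t) * indicator {(norm x)\<^sup>2..} t \<partial>lborel)" by simp
  qed
  also have "\<dots> = (\<integral>\<^sup>+ t. \<integral>\<^sup>+ (x::real^2). ennreal (f t) * indicator {(norm x)\<^sup>2..} t \<partial>lborel \<partial>lborel)"
    by (rule lborel_pair.Fubini'[symmetric]) (measurable, simp add: indicator_def, measurable)
  \<comment> \<open>After the exchange of integrals, the inner one is f(t) times the area pi t of
    the disc of radius sqrt t.\<close>
  also have "\<dots> = (\<integral>\<^sup>+ t. ennreal (8 * pi * t / (1 + t) ^ 3) * indicator {0..} t \<partial>lborel)"
  proof (intro nn_integral_cong)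
    fix t :: real
    show "(\<integral>\<^sup>+ (x::real^2). ennreal (f t) * indicator {(norm x)\<^sup>2..} t \<partial>lborel)
        = ennreal (8 * pi * t / (1 + t) ^ 3) * indicator {0..} t"
    proof (cases "t \<ge> 0")
      case True
      have le: "norm x \<le> sqrt t \<longleftrightarrow> (norm x)\<^sup>2 \<le> t" for x :: "real^2"
        using True real_sqrt_le_iff[of "(norm x)\<^sup>2" t] by simp
      have "(\<lambda>x::real^2. ennreal (f t) * indicator {(norm x)\<^sup>2..} t)
          = (\<lambda>x. ennreal (f t) * indicator (cball 0 (sqrt t)) x)"
        by (auto simp: fun_eq_iff indicator_def le)
      then have "(\<integral>\<^sup>+ (x::real^2). ennreal (f t) * indicator {(norm x)\<^sup>2..} t \<partial>lborel)
          = ennreal (f t) * emeasure lborel (cball (0::real^2) (sqrt t))"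
        by (simp add: nn_integral_cmult_indicator)
      also have "\<dots> = ennreal (f t) * ennreal (pi * t)"
        using True by (simp add: emeasure_cball eval_unit_ball_vol)
      also have "\<dots> = ennreal (8 * pi * t / (1 + t) ^ 3)"
        using True by (simp add: f_def ennreal_mult[symmetric] mult_ac)
      finally show ?thesis using True by simp
    next
      case False
      then have "\<not> (norm x)\<^sup>2 \<le> t" for x :: "real^2" by (meson order_trans zero_le_power2)
      with False show ?thesis by simp
    qed
  qed
  also have "\<dots> = ennreal (0 - 4 * pi * (1 / (1 + 0)\<^sup>2 - 2 / (1 + 0)))"
  \<comment> \<open>The primitive comes from t / (1 + t)^3 = 1 / (1 + t)^2 - 1 / (1 + t)^3.\<close>
  proof (rule nn_integral_FTC_atLeast[where F = "\<lambda>t. 4 * pi * (1 / (1 + t)\<^sup>2 - 2 / (1 + t))"])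
    fix t :: real assume t: "0 \<le> t"
    have "((\<lambda>t. 4 * pi * (1 / (1 + t)\<^sup>2 - 2 / (1 + t))) has_real_derivative
        4 * pi * (- 2 / (1 + t) ^ 3 + 2 / (1 + t)\<^sup>2)) (at t)"
      using DERIV_cmult[OF DERIV_diff[OF d[OF t]], of "4 * pi" 1 2] by simp
    also have "4 * pi * (- 2 / (1 + t) ^ 3 + 2 / (1 + t)\<^sup>2) = 8 * pi * t / (1 + t) ^ 3"
    proof -
      have "4 * pi * (- 2 / a ^ 3 + 2 / a\<^sup>2) = 8 * pi * (a - 1) / a ^ 3" if "a \<noteq> 0" for a :: real
        using that by (simp add: field_simps power3_eq_cube power2_eq_square)
      from this[of "1 + t"] t show ?thesis by simp
    qed
    finally show "((\<lambda>t. 4 * pi * (1 / (1 + t)\<^sup>2 - 2 / (1 + t))) has_real_derivative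
        8 * pi * t / (1 + t) ^ 3) (at t)" .
    show "0 \<le> 8 * pi * t / (1 + t) ^ 3" using t by simp
  next
    have "((\<lambda>t. 4 * pi * (1 / (1 + t)\<^sup>2 - 2 / (1 + t))) \<longlongrightarrow> 4 * pi * (0 - 0)) at_top"
      by (intro tendsto_intros tendsto_divide_0[OF tendsto_const] filterlim_at_top_imp_at_infinity
          filterlim_pow_at_top lim) simp
    then show "((\<lambda>t. 4 * pi * (1 / (1 + t)\<^sup>2 - 2 / (1 + t))) \<longlongrightarrow> 0) at_top" by simp
  qed measurable
  finally show "(\<integral>\<^sup>+ (x::real^2). ennreal (4 / (1 + (norm x)\<^sup>2)\<^sup>2) \<partial>lborel) = ennreal (4 * pi)" by simp
qed auto

section \<open>Metrics with a height profile\<close>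

definition height :: "real \<Rightarrow> real^2 \<Rightarrow> real" where
  "height \<epsilon> x = \<epsilon> * (1 - (norm x)\<^sup>2) / (1 + (norm x)\<^sup>2)"

lemma stereo_nth:
  "stereo \<epsilon> x $ 1 = 2 * x $ 1 / (1 + (norm x)\<^sup>2)"
  "stereo \<epsilon> x $ 2 = 2 * x $ 2 / (1 + (norm x)\<^sup>2)"
  "stereo \<epsilon> x $ 3 = height \<epsilon> x"
  by (simp_all add: stereo_def height_def)

lemma one_plus_norm_sq_pos: "1 + (norm x)\<^sup>2 > 0"
  by (simp add: add_pos_nonneg)

lemma one_plus_norm_sq_nonzero [simp]: "1 + (norm x)\<^sup>2 \<noteq> 0"
  using one_plus_norm_sq_pos[of x] by simp

lemma one_minus_height_sq:
  assumes "\<epsilon> \<in> {1, -1}"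
  shows "1 - (height \<epsilon> x)\<^sup>2 = 4 * (norm x)\<^sup>2 / (1 + (norm x)\<^sup>2)\<^sup>2"
proof -
  have "\<epsilon>\<^sup>2 = 1" using assms by auto
  then have "(height \<epsilon> x)\<^sup>2 = (1 - (norm x)\<^sup>2)\<^sup>2 / (1 + (norm x)\<^sup>2)\<^sup>2"
    by (simp add: height_def power_mult_distrib power_divide)
  then have "1 - (height \<epsilon> x)\<^sup>2 = ((1 + (norm x)\<^sup>2)\<^sup>2 - (1 - (norm x)\<^sup>2)\<^sup>2) / (1 + (norm x)\<^sup>2)\<^sup>2"
    by (simp add: diff_divide_distrib)
  also have "(1 + (norm x)\<^sup>2)\<^sup>2 - (1 - (norm x)\<^sup>2)\<^sup>2 = 4 * (norm x)\<^sup>2"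
    by (simp add: power2_eq_square algebra_simps)
  finally show ?thesis .
qed

lemma abs_height_le: "\<epsilon> \<in> {1, -1} \<Longrightarrow> \<bar>height \<epsilon> x\<bar> \<le> 1"
proof -
  assume "\<epsilon> \<in> {1, -1}"
  then have "0 \<le> 1 - (height \<epsilon> x)\<^sup>2" unfolding one_minus_height_sq[OF \<open>\<epsilon> \<in> {1, -1}\<close>] by simp
  then show ?thesis by (simp flip: abs_square_le_1)
qed

lemma smooth_norm_sq: "smooth (\<lambda>x. (norm x)\<^sup>2)"
  unfolding norm2_sq by (intro smooth_intros)

lemma smooth_height: "smooth (height \<epsilon>)"
  unfolding height_def by (intro smooth_intros smooth_norm_sq) simp

lemma has_derivative_norm_sq:
  "((\<lambda>x::'a::real_inner. (norm x)\<^sup>2) has_derivative (\<lambda>d. 2 * (x \<bullet> d))) (at x)"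
  unfolding power2_norm_eq_inner by (auto intro!: derivative_eq_intros simp: inner_commute)

lemma has_derivative_nth: "((\<lambda>x. x $ i) has_derivative (\<lambda>d. d $ i)) (at x)"
  by (intro bounded_linear_imp_has_derivative bounded_linear_vec_nth)

lemma has_derivative_height:
  "(height \<epsilon> has_derivative (\<lambda>d. - 4 * \<epsilon> * (x \<bullet> d) / (1 + (norm x)\<^sup>2)\<^sup>2)) (at x)"
proof -
  have "(height \<epsilon> has_derivative (\<lambda>d. ((\<epsilon> * (- (2 * (x \<bullet> d)))) * (1 + (norm x)\<^sup>2)
      - \<epsilon> * (1 - (norm x)\<^sup>2) * (2 * (x \<bullet> d))) / ((1 + (norm x)\<^sup>2) * (1 + (norm x)\<^sup>2)))) (at x)"
    unfolding height_def
    by (rule derivative_eq_intros has_derivative_norm_sq refl one_plus_norm_sq_nonzero)+ simp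
  moreover have "(\<epsilon> * (- (2 * (x \<bullet> d)))) * (1 + (norm x)\<^sup>2) - \<epsilon> * (1 - (norm x)\<^sup>2) * (2 * (x \<bullet> d))
      = - 4 * \<epsilon> * (x \<bullet> d)" for d
    by (simp add: algebra_simps)
  ultimately show ?thesis by (simp add: power2_eq_square)
qed

lemma has_derivative_nth_div:
  "((\<lambda>x. k * x $ i / (1 + (norm x)\<^sup>2)) has_derivative
     (\<lambda>d. k * d $ i / (1 + (norm x)\<^sup>2) - k * x $ i * (2 * (x \<bullet> d)) / (1 + (norm x)\<^sup>2)\<^sup>2)) (at x)"
proof -
  have "((\<lambda>x. k * x $ i / (1 + (norm x)\<^sup>2)) has_derivative (\<lambda>d. (k * d $ i * (1 + (norm x)\<^sup>2)
      - k * x $ i * (2 * (x \<bullet> d))) / ((1 + (norm x)\<^sup>2) * (1 + (norm x)\<^sup>2)))) (at x)"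
    by (rule derivative_eq_intros has_derivative_norm_sq has_derivative_nth refl
        one_plus_norm_sq_nonzero)+ simp
  moreover have "(p * a - q) / (a * a) = p / a - q / a\<^sup>2" if "a \<noteq> 0" for a p q :: real
    using that by (simp add: field_simps power2_eq_square)
  ultimately show ?thesis by (simp only: one_plus_norm_sq_nonzero not_False_eq_True)
qed

lemma inner_axis_one: "(x :: real^'n) \<bullet> axis i 1 = x $ i"
  by (simp add: inner_axis)

lemma partial_stereo:
  "partial i (stereo \<epsilon>) x = vector
     [2 * axis i 1 $ 1 / (1 + (norm x)\<^sup>2) - 4 * x $ 1 * x $ i / (1 + (norm x)\<^sup>2)\<^sup>2,
      2 * axis i 1 $ 2 / (1 + (norm x)\<^sup>2) - 4 * x $ 2 * x $ i / (1 + (norm x)\<^sup>2)\<^sup>2,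
      - 4 * \<epsilon> * x $ i / (1 + (norm x)\<^sup>2)\<^sup>2]"
proof -
  have eq: "stereo \<epsilon> = (\<lambda>x. (2 * x $ 1 / (1 + (norm x)\<^sup>2)) *\<^sub>R axis 1 1
      + (2 * x $ 2 / (1 + (norm x)\<^sup>2)) *\<^sub>R axis 2 1 + height \<epsilon> x *\<^sub>R axis 3 1)"
    by (rule ext) (simp add: vec_eq_iff forall_3 stereo_nth axis_def)
  have d: "((\<lambda>x. (2 * x $ 1 / (1 + (norm x)\<^sup>2)) *\<^sub>R axis 1 1
      + (2 * x $ 2 / (1 + (norm x)\<^sup>2)) *\<^sub>R axis 2 1 + height \<epsilon> x *\<^sub>R axis 3 1) has_derivative
      (\<lambda>d. (2 * d $ 1 / (1 + (norm x)\<^sup>2) - 2 * x $ 1 * (2 * (x \<bullet> d)) / (1 + (norm x)\<^sup>2)\<^sup>2) *\<^sub>R axis 1 1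
        + (2 * d $ 2 / (1 + (norm x)\<^sup>2) - 2 * x $ 2 * (2 * (x \<bullet> d)) / (1 + (norm x)\<^sup>2)\<^sup>2) *\<^sub>R axis 2 1
        + (- 4 * \<epsilon> * (x \<bullet> d) / (1 + (norm x)\<^sup>2)\<^sup>2) *\<^sub>R axis 3 (1::real))) (at x)"
    by (intro has_derivative_add has_derivative_scaleR_left has_derivative_nth_div has_derivative_height)
  have "partial i (stereo \<epsilon>) x =
      (\<lambda>d. (2 * d $ 1 / (1 + (norm x)\<^sup>2) - 2 * x $ 1 * (2 * (x \<bullet> d)) / (1 + (norm x)\<^sup>2)\<^sup>2) *\<^sub>R axis 1 1
        + (2 * d $ 2 / (1 + (norm x)\<^sup>2) - 2 * x $ 2 * (2 * (x \<bullet> d)) / (1 + (norm x)\<^sup>2)\<^sup>2) *\<^sub>R axis 2 1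
        + (- 4 * \<epsilon> * (x \<bullet> d) / (1 + (norm x)\<^sup>2)\<^sup>2) *\<^sub>R axis 3 (1::real)) (axis i 1)"
    unfolding eq by (rule partial_eq[OF d])
  then show ?thesis by (simp add: inner_axis_one vec_eq_iff forall_3) (simp add: axis_def)
qed

text \<open>On tangent vectors this is \<psi>(z) times the round metric plus \<kappa>(z) dz^2. No
  angular coordinate enters, so the formula makes sense at the poles as well.\<close>

definition profile_metric :: "(real \<Rightarrow> real) \<Rightarrow> (real \<Rightarrow> real) \<Rightarrow> metric" where
  "profile_metric \<psi> \<kappa> p u v = \<psi> (p $ 3) * (u \<bullet> v) + \<kappa> (p $ 3) * (u $ 3 * v $ 3)"

lemma inner_3: "(u :: real^3) \<bullet> v = u $ 1 * v $ 1 + u $ 2 * v $ 2 + u $ 3 * v $ 3"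
  by (simp add: inner_vec_def sum_3)

lemma inner_2: "(u :: real^2) \<bullet> v = u $ 1 * v $ 1 + u $ 2 * v $ 2"
  by (simp add: inner_vec_def sum_2)

text \<open>Stereographic projection is conformal, with factor 4 / (1 + |x|^2)^2;
  \<open>axis i 1 $ j\<close> serves as the Kronecker delta.\<close>

lemma inner_partial_stereo:
  assumes "\<epsilon> \<in> {1, -1}"
  shows "partial i (stereo \<epsilon>) x \<bullet> partial j (stereo \<epsilon>) x
      = 4 / (1 + (norm x)\<^sup>2)\<^sup>2 * axis i 1 $ j"
proof -
  define \<rho> where "\<rho> = 1 + (norm x)\<^sup>2"
  have \<rho>: "\<rho> \<noteq> 0" "(x $ 1)\<^sup>2 + (x $ 2)\<^sup>2 = \<rho> - 1"
    unfolding \<rho>_def by (simp, simp add: norm2_sq)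
  \<comment> \<open>Replacing division by powers of \<open>t\<close> turns the claim into a
    polynomial identity.\<close>
  define t where "t = 1 / \<rho>"
  have t: "\<rho> * t = 1" using \<rho> by (simp add: t_def)
  have e: "\<epsilon>\<^sup>2 = 1" using assms by auto
  have [simp]: "a / \<rho> = a * t" "a / \<rho>\<^sup>2 = a * t\<^sup>2" for a by (simp_all add: t_def power_divide)
  have "(2 * axis i 1 $ 1 * t - 4 * x $ 1 * x $ i * t\<^sup>2) * (2 * axis j 1 $ 1 * t - 4 * x $ 1 * x $ j * t\<^sup>2)
      + (2 * axis i 1 $ 2 * t - 4 * x $ 2 * x $ i * t\<^sup>2) * (2 * axis j 1 $ 2 * t - 4 * x $ 2 * x $ j * t\<^sup>2)
      + (4 * \<epsilon> * x $ i * t\<^sup>2) * (4 * \<epsilon> * x $ j * t\<^sup>2)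
    = 4 * t\<^sup>2 * (axis i 1 $ 1 * axis j 1 $ 1 + axis i 1 $ 2 * axis j 1 $ 2)
      - 8 * t ^ 3 * (x $ i * (x $ 1 * axis j 1 $ 1 + x $ 2 * axis j 1 $ 2)
                   + x $ j * (x $ 1 * axis i 1 $ 1 + x $ 2 * axis i 1 $ 2))
      + 16 * t ^ 4 * x $ i * x $ j * ((x $ 1)\<^sup>2 + (x $ 2)\<^sup>2 + \<epsilon>\<^sup>2)"
    by (simp add: power2_eq_square power3_eq_cube power4_eq_xxxx algebra_simps)
  \<comment> \<open>The bracket equals \<rho>, which absorbs one factor \<open>t\<close>; what
    remains cancels the two cross terms of order t^3.\<close>
  also have "16 * t ^ 4 * x $ i * x $ j * ((x $ 1)\<^sup>2 + (x $ 2)\<^sup>2 + \<epsilon>\<^sup>2) = 16 * t ^ 3 * x $ i * x $ j"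
  proof -
    have "t ^ 4 * \<rho> = t ^ 3" using t by (simp add: power3_eq_cube power4_eq_xxxx mult_ac)
    then show ?thesis unfolding e \<rho>(2) by (simp add: mult_ac)
  qed
  also have "4 * t\<^sup>2 * (axis i 1 $ 1 * axis j 1 $ 1 + axis i 1 $ 2 * axis j 1 $ 2)
      - 8 * t ^ 3 * (x $ i * (x $ 1 * axis j 1 $ 1 + x $ 2 * axis j 1 $ 2)
                   + x $ j * (x $ 1 * axis i 1 $ 1 + x $ 2 * axis i 1 $ 2))
      + 16 * t ^ 3 * x $ i * x $ j = 4 * t\<^sup>2 * axis i 1 $ j"
    using inner_axis_one[of x i] inner_axis_one[of x j] inner_axis_one[of "axis i 1" j]
    by (simp add: inner_2)
  finally show ?thesis
    unfolding partial_stereo inner_3 \<rho>_def[symmetric] by (simp add: mult_ac)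
qed

text \<open>The first term is conformality; the second holds because dz is a radial multiple of x .
  dx in the chart. Both coefficients depend on |x|^2 alone, which the curvature computation
  exploits.\<close>

lemma pullback_profile_metric:
  assumes "\<epsilon> \<in> {1, -1}"
  shows "pullback (profile_metric \<psi> \<kappa>) \<epsilon> x $ i $ j =
     4 * \<psi> (height \<epsilon> x) / (1 + (norm x)\<^sup>2)\<^sup>2 * axis i 1 $ j
     + 16 * \<kappa> (height \<epsilon> x) / (1 + (norm x)\<^sup>2) ^ 4 * (x $ i * x $ j)"
proof -
  have e: "\<epsilon> * \<epsilon> = 1" using assms by auto
  have "partial i (stereo \<epsilon>) x $ 3 * partial j (stereo \<epsilon>) x $ 3
      = (\<epsilon> * \<epsilon>) * 16 * (x $ i * x $ j) / ((1 + (norm x)\<^sup>2)\<^sup>2 * (1 + (norm x)\<^sup>2)\<^sup>2)"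
    unfolding partial_stereo by (simp add: mult_ac)
  also have "\<epsilon> * \<epsilon> = 1" by (rule e)
  also have "(1 + (norm x)\<^sup>2)\<^sup>2 * (1 + (norm x)\<^sup>2)\<^sup>2 = (1 + (norm x)\<^sup>2) ^ 4"
    by (simp flip: power_add)
  finally show ?thesis
    unfolding pullback_def profile_metric_def inner_partial_stereo[OF assms] stereo_nth
    by (simp add: mult_ac)
qed

lemma has_derivative_nth_div_sq:
  "((\<lambda>x. k * x $ i / (1 + (norm x)\<^sup>2)\<^sup>2) has_derivative
     (\<lambda>d. k * d $ i / (1 + (norm x)\<^sup>2)\<^sup>2 - k * x $ i * (4 * (x \<bullet> d)) / (1 + (norm x)\<^sup>2) ^ 3)) (at x)"
proof -
  have "((\<lambda>x. k * x $ i / (1 + (norm x)\<^sup>2)\<^sup>2) has_derivative (\<lambda>d. (k * d $ i * (1 + (norm x)\<^sup>2)\<^sup>2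
      - k * x $ i * (2 * (2 * (x \<bullet> d)) * (1 + (norm x)\<^sup>2))) / ((1 + (norm x)\<^sup>2)\<^sup>2 * (1 + (norm x)\<^sup>2)\<^sup>2))) (at x)"
    by (rule derivative_eq_intros has_derivative_norm_sq has_derivative_nth refl
        one_plus_norm_sq_nonzero)+ auto
  moreover have "(p * a\<^sup>2 - q * (2 * (2 * s) * a)) / (a\<^sup>2 * a\<^sup>2) = p / a\<^sup>2 - q * (4 * s) / a ^ 3"
    if "a \<noteq> 0" for a p q s :: real
    using that by (simp add: field_simps power2_eq_square power3_eq_cube)
  ultimately show ?thesis by (simp only: one_plus_norm_sq_nonzero not_False_eq_True)
qed

section \<open>Evaluating the matrix inverse\<close>

lemma matrix_inv_unique_2:
  fixes A B :: "real^'n^'n"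
  assumes "A ** B = mat 1"
  shows "matrix_inv A = B"
proof -
  have B: "B ** A = mat 1" using assms matrix_left_right_inverse by blast
  have "A ** matrix_inv A = mat 1 \<and> matrix_inv A ** A = mat 1"
    unfolding matrix_inv_def by (rule someI[of _ B]) (use assms B in simp)
  then have "matrix_inv A ** A ** B = B" by simp
  then show ?thesis by (simp add: assms flip: matrix_mul_assoc)
qed

lemma matrix_inv_vector:
  fixes A :: "real^'n^'n"
  assumes "det A \<noteq> 0"
  shows "matrix_inv A *v (A *v x) = x"
proof -
  obtain B where "A ** B = mat 1" using assms by (auto simp: invertible_det_nz[symmetric] invertible_def)
  then have "matrix_inv A ** A = mat 1" using matrix_inv_unique_2 matrix_left_right_inverse by metis
  then show ?thesis by (simp add: matrix_vector_mul_assoc)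
qed

lemma axis_nth_sym: "axis i (1::real) $ j = axis j 1 $ i"
  by (simp add: axis_def)

text \<open>In terms of the height \<open>z\<close> and the longitude, \<open>profile_metric \<psi> \<kappa>\<close> is
  \<open>dz\<^sup>2 / \<phi> + \<phi> d\<theta>\<^sup>2\<close> with \<open>\<phi> = (1 - z\<^sup>2) \<psi>\<close>: the condition on \<open>\<kappa>\<close> makes its area form
  that of the round sphere.\<close>

locale unit_density_profile =
  fixes \<psi> \<kappa> :: "real \<Rightarrow> real"
  assumes \<psi>_pos: "\<bar>z\<bar> \<le> 1 \<Longrightarrow> \<psi> z > 0"
    and unit_density: "\<bar>z\<bar> \<le> 1 \<Longrightarrow> \<psi> z * (\<psi> z + \<kappa> z * (1 - z\<^sup>2)) = 1"
begin

text \<open>The radial vector x is an eigenvector, with eigenvalue 4 (\<psi> + \<kappa> (1 - z^2)) /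
  (1 + |x|^2)^2; unit density turns the bracket into 1/\<psi>. Gradients of functions of the height
  can thus be read off without inverting the matrix.\<close>

lemma pullback_vector:
  assumes "\<epsilon> \<in> {1, -1}"
  shows "pullback (profile_metric \<psi> \<kappa>) \<epsilon> x *v (\<psi> (height \<epsilon> x) *\<^sub>R x) = (4 / (1 + (norm x)\<^sup>2)\<^sup>2) *\<^sub>R x"
proof -
  define \<rho> z where "\<rho> = 1 + (norm x)\<^sup>2" and "z = height \<epsilon> x"
  have \<rho>: "\<rho> \<noteq> 0" by (simp add: \<rho>_def)
  have "1 - z\<^sup>2 = 4 * (norm x)\<^sup>2 / \<rho>\<^sup>2" "\<bar>z\<bar> \<le> 1"
    using one_minus_height_sq[OF assms] abs_height_le[OF assms] by (simp_all add: \<rho>_def z_def)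
  then have u: "\<psi> z * (\<psi> z + \<kappa> z * (4 * (norm x)\<^sup>2 / \<rho>\<^sup>2)) = 1" using unit_density by metis
  have "(\<Sum>j\<in>UNIV. (4 * \<psi> z / \<rho>\<^sup>2 * axis i 1 $ j + 16 * \<kappa> z / \<rho> ^ 4 * (x $ i * x $ j)) * (\<psi> z * x $ j))
      = 4 / \<rho>\<^sup>2 * x $ i" for i
  proof -
    have ax: "(\<Sum>j\<in>UNIV. axis i 1 $ j * x $ j) = x $ i"
      using inner_axis_one[of x i] by (simp add: inner_vec_def mult.commute)
    have "(\<Sum>j\<in>UNIV. (4 * \<psi> z / \<rho>\<^sup>2 * axis i 1 $ j + 16 * \<kappa> z / \<rho> ^ 4 * (x $ i * x $ j)) * (\<psi> z * x $ j))
      = 4 * \<psi> z / \<rho>\<^sup>2 * \<psi> z * (\<Sum>j\<in>UNIV. axis i 1 $ j * x $ j)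
        + 16 * \<kappa> z / \<rho> ^ 4 * \<psi> z * x $ i * (norm x)\<^sup>2"
      unfolding sum_2 norm2_sq by (simp add: algebra_simps power2_eq_square add_divide_distrib)
    also have "\<dots> = 4 / \<rho>\<^sup>2 * (\<psi> z * (\<psi> z + \<kappa> z * (4 * (norm x)\<^sup>2 / \<rho>\<^sup>2))) * x $ i"
      unfolding ax using \<rho> by (simp add: field_simps power2_eq_square power4_eq_xxxx)
    finally show ?thesis unfolding u by simp
  qed
  then show ?thesis
    by (simp add: vec_eq_iff matrix_vector_mult_def pullback_profile_metric[OF assms] \<rho>_def z_def)
qed

text \<open>The factor \<psi> in the direction of the parallels and the factor 1/\<psi> in the
  radial direction cancel, which leaves the determinant of the round metric.\<close>

lemma det_pullback:
  assumes "\<epsilon> \<in> {1, -1}"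
  shows "det (pullback (profile_metric \<psi> \<kappa>) \<epsilon> x) = (4 / (1 + (norm x)\<^sup>2)\<^sup>2)\<^sup>2"
proof -
  define \<rho> z where "\<rho> = 1 + (norm x)\<^sup>2" and "z = height \<epsilon> x"
  have \<rho>: "\<rho> \<noteq> 0" by (simp add: \<rho>_def)
  have "1 - z\<^sup>2 = 4 * (norm x)\<^sup>2 / \<rho>\<^sup>2" "\<bar>z\<bar> \<le> 1"
    using one_minus_height_sq[OF assms] abs_height_le[OF assms] by (simp_all add: \<rho>_def z_def)
  then have u: "\<psi> z * (\<psi> z + \<kappa> z * (4 * (norm x)\<^sup>2 / \<rho>\<^sup>2)) = 1" using unit_density by metis
  have det: "(a * (axis 1 1 :: real^2) $ 1 + b * (x $ 1 * x $ 1)) * (a * (axis 2 1 :: real^2) $ 2 + b * (x $ 2 * x $ 2))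
      - (a * (axis 1 1 :: real^2) $ 2 + b * (x $ 1 * x $ 2)) * (a * (axis 2 1 :: real^2) $ 1 + b * (x $ 2 * x $ 1))
      = a * (a + b * (norm x)\<^sup>2)" for a b
    unfolding norm2_sq by (simp add: axis_def algebra_simps power2_eq_square)
  have "det (pullback (profile_metric \<psi> \<kappa>) \<epsilon> x)
      = (4 * \<psi> z / \<rho>\<^sup>2) * (4 * \<psi> z / \<rho>\<^sup>2 + 16 * \<kappa> z / \<rho> ^ 4 * (norm x)\<^sup>2)"
    unfolding det_2 pullback_profile_metric[OF assms] \<rho>_def[symmetric] z_def[symmetric] by (rule det)
  also have "\<dots> = (4 / \<rho>\<^sup>2)\<^sup>2 * (\<psi> z * (\<psi> z + \<kappa> z * (4 * (norm x)\<^sup>2 / \<rho>\<^sup>2)))"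
    using \<rho> by (simp add: field_simps power2_eq_square power4_eq_xxxx)
  finally show ?thesis unfolding u by (simp add: \<rho>_def)
qed

lemma sqrt_det_pullback:
  assumes "\<epsilon> \<in> {1, -1}"
  shows "sqrt (det (pullback (profile_metric \<psi> \<kappa>) \<epsilon> x)) = 4 / (1 + (norm x)\<^sup>2)\<^sup>2"
  unfolding det_pullback[OF assms] by simp

lemma has_area_profile_metric: "has_area (profile_metric \<psi> \<kappa>) (4 * pi)"
  unfolding has_area_def using has_bochner_integral_round_area by (simp add: sqrt_det_pullback)

text \<open>Negative \<kappa> is the delicate case. Tangency and Cauchy-Schwarz bound the squared
  vertical component of \<open>u\<close> by (1 - z^2) |u|^2, and \<psi> + \<kappa> (1 - z^2) is
  positive because its product with \<psi> is 1.\<close>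

lemma profile_metric_pos:
  assumes "p \<in> S2" "u \<in> tangent_space p" "u \<noteq> 0"
  shows "profile_metric \<psi> \<kappa> p u u > 0"
proof -
  define z where "z = p $ 3"
  have p: "(p $ 1)\<^sup>2 + (p $ 2)\<^sup>2 = 1 - z\<^sup>2" using assms(1) norm3_sq[of p] by (simp add: z_def)
  then have "1 - z\<^sup>2 \<ge> 0" by (metis add_nonneg_nonneg zero_le_power2)
  then have z: "\<bar>z\<bar> \<le> 1" by (simp flip: abs_square_le_1)
  have n: "u \<bullet> u > 0" using assms(3) by simp
  have "p $ 1 * u $ 1 + p $ 2 * u $ 2 = - z * u $ 3"
    using assms(2) by (simp add: tangent_space_def inner_3 z_def algebra_simps eq_neg_iff_add_eq_0)
  then have "(z * u $ 3)\<^sup>2 = (p $ 1 * u $ 1 + p $ 2 * u $ 2)\<^sup>2" by simp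
  also have "\<dots> = ((p $ 1)\<^sup>2 + (p $ 2)\<^sup>2) * ((u $ 1)\<^sup>2 + (u $ 2)\<^sup>2) - (p $ 1 * u $ 2 - p $ 2 * u $ 1)\<^sup>2"
    by (simp add: power2_eq_square algebra_simps)
  also have "\<dots> \<le> ((p $ 1)\<^sup>2 + (p $ 2)\<^sup>2) * ((u $ 1)\<^sup>2 + (u $ 2)\<^sup>2)" by simp
  finally have u3: "(u $ 3)\<^sup>2 \<le> (1 - z\<^sup>2) * (u \<bullet> u)"
    unfolding p by (simp add: inner_3 power2_eq_square algebra_simps)
  show ?thesis
  proof (cases "\<kappa> z \<ge> 0")
    case True
    then have "\<psi> z * (u \<bullet> u) + \<kappa> z * (u $ 3 * u $ 3) > 0"
      using n \<psi>_pos[OF z] by (intro add_pos_nonneg) auto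
    then show ?thesis by (simp add: profile_metric_def z_def)
  next
    case False
    have "\<psi> z + \<kappa> z * (1 - z\<^sup>2) > 0"
      using unit_density[OF z] \<psi>_pos[OF z] by (metis zero_less_mult_pos zero_less_one)
    then have "0 < (\<psi> z + \<kappa> z * (1 - z\<^sup>2)) * (u \<bullet> u)" using n by simp
    also have "\<dots> = \<psi> z * (u \<bullet> u) + \<kappa> z * ((1 - z\<^sup>2) * (u \<bullet> u))" by (simp add: algebra_simps)
    also have "\<dots> \<le> \<psi> z * (u \<bullet> u) + \<kappa> z * (u $ 3)\<^sup>2"
      using u3 False by (intro add_left_mono mult_left_mono_neg) auto
    finally show ?thesis by (simp add: profile_metric_def z_def power2_eq_square)
  qed
qed

lemma S1_invariant_profile_metric:
  assumes "\<And>\<epsilon>. \<epsilon> \<in> {1, -1} \<Longrightarrow> smooth (\<lambda>x. \<psi> (height \<epsilon> x))"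
    and "\<And>\<epsilon>. \<epsilon> \<in> {1, -1} \<Longrightarrow> smooth (\<lambda>x. \<kappa> (height \<epsilon> x))"
  shows "S1_invariant_metric (profile_metric \<psi> \<kappa>)"
  unfolding S1_invariant_metric_def riemannian_metric_def
proof (intro conjI ballI allI impI)
  fix \<theta> :: real and p u v
  have "(C * a - S * b) * (C * a' - S * b') + (S * a + C * b) * (S * a' + C * b')
      = (S\<^sup>2 + C\<^sup>2) * (a * a' + b * b')" for S C a b a' b' :: real
    by (simp add: algebra_simps power2_eq_square)
  note this[of "cos \<theta>" _ "sin \<theta>", unfolded sin_cos_squared_add mult_1]
  then show "profile_metric \<psi> \<kappa> (rotate \<theta> p) (rotate \<theta> u) (rotate \<theta> v) = profile_metric \<psi> \<kappa> p u v"
    by (simp add: profile_metric_def inner_3 rotate_def)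
next
  fix \<epsilon> :: real and i j assume e: "\<epsilon> \<in> {1, -1}"
  show "smooth (\<lambda>x. pullback (profile_metric \<psi> \<kappa>) \<epsilon> x $ i $ j)"
    unfolding pullback_profile_metric[OF e]
    by (intro smooth_intros smooth_norm_sq assms e) simp_all
next
  show "profile_metric \<psi> \<kappa> p u u > 0" if "p \<in> S2" "u \<in> tangent_space p" "u \<noteq> 0" for p u
    using that by (rule profile_metric_pos)
qed (auto simp: profile_metric_def inner_commute inner_left_distrib algebra_simps)

text \<open>The differential of a function of the height is radial, so
  \<open>pullback_vector\<close> inverts the metric on it. Agreement with \<open>W\<close> is asked
  only where the height lies in \<open>T\<close>, since profiles of general invariant functions are
  differentiated only away from the poles.\<close>

lemma gradient_height_function:
  assumes e: "\<epsilon> \<in> {1, -1}" and W: "(W has_real_derivative W') (at (height \<epsilon> x))"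
    and T: "open T" "height \<epsilon> x \<in> T" and v: "\<And>y. height \<epsilon> y \<in> T \<Longrightarrow> v y = W (height \<epsilon> y)"
  shows "gradient (pullback (profile_metric \<psi> \<kappa>) \<epsilon>) v x = (- \<epsilon> * (\<psi> (height \<epsilon> x) * W')) *\<^sub>R x"
proof -
  have op: "open (height \<epsilon> -` T)"
    using T(1) smooth_isCont[OF smooth_height] by (intro continuous_open_vimage)
  have "((\<lambda>y. W (height \<epsilon> y)) has_derivative (\<lambda>d. W' * (- 4 * \<epsilon> * (x \<bullet> d) / (1 + (norm x)\<^sup>2)\<^sup>2))) (at x)"
    using has_derivative_compose[OF has_derivative_height W[unfolded has_field_derivative_def]] .
  then have "(v has_derivative (\<lambda>d. W' * (- 4 * \<epsilon> * (x \<bullet> d) / (1 + (norm x)\<^sup>2)\<^sup>2))) (at x)"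
    by (rule has_derivative_transform_within_open[OF _ op]) (use T v in auto)
  then have "(\<chi> j. partial j v x) = (- \<epsilon> * W') *\<^sub>R (4 / (1 + (norm x)\<^sup>2)\<^sup>2) *\<^sub>R x"
    by (simp add: partial_eq inner_axis_one vec_eq_iff)
  also have "\<dots> = pullback (profile_metric \<psi> \<kappa>) \<epsilon> x *v ((- \<epsilon> * W') *\<^sub>R \<psi> (height \<epsilon> x) *\<^sub>R x)"
    by (simp only: pullback_vector[OF e, symmetric] matrix_vector_mult_scaleR)
  finally have "(\<chi> j. partial j v x)
      = pullback (profile_metric \<psi> \<kappa>) \<epsilon> x *v ((- \<epsilon> * W') *\<^sub>R \<psi> (height \<epsilon> x) *\<^sub>R x)" .
  moreover have "det (pullback (profile_metric \<psi> \<kappa>) \<epsilon> x) \<noteq> 0"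
    by (simp add: det_pullback[OF e])
  ultimately show ?thesis unfolding gradient_def by (simp add: matrix_inv_vector mult_ac)
qed

text \<open>The right-hand side is -((1 - z^2) \<psi> W')' expanded by the product rule.
  Differentiability is imposed on the product \<psi> W', which is what the flux contains.\<close>

lemma coord_laplacian_height_function:
  assumes e: "\<epsilon> \<in> {1, -1}" and W: "\<And>t. t \<in> T \<Longrightarrow> (W has_real_derivative W' t) (at t)"
    and M: "((\<lambda>t. \<psi> t * W' t) has_real_derivative M') (at (height \<epsilon> x))"
    and T: "open T" "height \<epsilon> x \<in> T" and v: "\<And>y. height \<epsilon> y \<in> T \<Longrightarrow> v y = W (height \<epsilon> y)"
  shows "coord_laplacian (pullback (profile_metric \<psi> \<kappa>) \<epsilon>) v x
    = 2 * height \<epsilon> x * (\<psi> (height \<epsilon> x) * W' (height \<epsilon> x)) - (1 - (height \<epsilon> x)\<^sup>2) * M'"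
proof -
  let ?h = "pullback (profile_metric \<psi> \<kappa>) \<epsilon>"
  define m where "m = \<psi> (height \<epsilon> x) * W' (height \<epsilon> x)"
  have op: "open (height \<epsilon> -` T)"
    using T(1) smooth_isCont[OF smooth_height] by (intro continuous_open_vimage)
  have D: "partial i (\<lambda>y. sqrt (det (?h y)) * gradient ?h v y $ i) x
      = (m * (- 4 * \<epsilon> / (1 + (norm x)\<^sup>2)\<^sup>2 - (- 4 * \<epsilon>) * x $ i * (4 * x $ i) / (1 + (norm x)\<^sup>2) ^ 3)
         + M' * (- 4 * \<epsilon> * x $ i / (1 + (norm x)\<^sup>2)\<^sup>2) * (- 4 * \<epsilon> * x $ i / (1 + (norm x)\<^sup>2)\<^sup>2))" for i
  proof -
    have "((\<lambda>y. \<psi> (height \<epsilon> y) * W' (height \<epsilon> y)) has_derivative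
        (\<lambda>d. M' * (- 4 * \<epsilon> * (x \<bullet> d) / (1 + (norm x)\<^sup>2)\<^sup>2))) (at x)"
      using has_derivative_compose[OF has_derivative_height M[unfolded has_field_derivative_def]] .
    from has_derivative_mult[OF this has_derivative_nth_div_sq[of "- 4 * \<epsilon>" i]]
    have "((\<lambda>y. (\<psi> (height \<epsilon> y) * W' (height \<epsilon> y)) * (- 4 * \<epsilon> * y $ i / (1 + (norm y)\<^sup>2)\<^sup>2)) has_derivative
        (\<lambda>d. m * (- 4 * \<epsilon> * d $ i / (1 + (norm x)\<^sup>2)\<^sup>2 - - 4 * \<epsilon> * x $ i * (4 * (x \<bullet> d)) / (1 + (norm x)\<^sup>2) ^ 3)
          + M' * (- 4 * \<epsilon> * (x \<bullet> d) / (1 + (norm x)\<^sup>2)\<^sup>2) * (- 4 * \<epsilon> * x $ i / (1 + (norm x)\<^sup>2)\<^sup>2))) (at x)"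
      unfolding m_def .
    then have "((\<lambda>y. sqrt (det (?h y)) * gradient ?h v y $ i) has_derivative
        (\<lambda>d. m * (- 4 * \<epsilon> * d $ i / (1 + (norm x)\<^sup>2)\<^sup>2 - - 4 * \<epsilon> * x $ i * (4 * (x \<bullet> d)) / (1 + (norm x)\<^sup>2) ^ 3)
          + M' * (- 4 * \<epsilon> * (x \<bullet> d) / (1 + (norm x)\<^sup>2)\<^sup>2) * (- 4 * \<epsilon> * x $ i / (1 + (norm x)\<^sup>2)\<^sup>2))) (at x)"
    proof (rule has_derivative_transform_within_open[OF _ op])
      fix y assume "y \<in> height \<epsilon> -` T"
      then have "gradient ?h v y = (- \<epsilon> * (\<psi> (height \<epsilon> y) * W' (height \<epsilon> y))) *\<^sub>R y"
        using gradient_height_function[OF e W T(1) _ v] by simp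
      then show "\<psi> (height \<epsilon> y) * W' (height \<epsilon> y) * (- 4 * \<epsilon> * y $ i / (1 + (norm y)\<^sup>2)\<^sup>2)
          = sqrt (det (?h y)) * gradient ?h v y $ i"
        by (simp add: sqrt_det_pullback[OF e])
    qed (use T in auto)
    then show ?thesis by (simp add: partial_eq inner_axis_one)
  qed
  \<comment> \<open>In the variables \<open>t\<close> and \<open>r\<close> the divergence is
    polynomial up to division by 4 t^2; the rewrite rules \<open>ee\<close> and \<open>r\<close>
    eliminate the square of \<epsilon> and of the first coordinate.\<close>
  define \<rho> t r where "\<rho> = 1 + (norm x)\<^sup>2" and "t = 1 / \<rho>" and "r = (norm x)\<^sup>2"
  have t: "t \<noteq> 0" "\<And>a. a / \<rho> = a * t" "\<And>a n. a / \<rho> ^ n = a * t ^ n"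
    by (simp_all add: t_def \<rho>_def r_def power_divide)
  have ee: "\<epsilon> * (\<epsilon> * a) = a" for a using e by auto
  have r: "x $ 1 * (x $ 1 * a) = r * a - x $ 2 * (x $ 2 * a)" for a
    unfolding r_def norm2_sq by (simp add: power2_eq_square algebra_simps)
  have "divergence ?h (gradient ?h v) x = (16 * M' * r * t ^ 4 - 8 * \<epsilon> * m * t\<^sup>2 * (1 - 2 * (r * t))) / (4 * t\<^sup>2)"
    unfolding divergence_def D
    unfolding sqrt_det_pullback[OF e] \<rho>_def[symmetric] sum_2 t(2,3)
    by (simp add: algebra_simps power2_eq_square power3_eq_cube power4_eq_xxxx ee r)
  also have "\<dots> = (4 * r / \<rho>\<^sup>2) * M' - 2 * (\<epsilon> * (1 - 2 * (r * t))) * m"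
    unfolding t(3) using t(1) by (simp add: field_simps power2_eq_square power4_eq_xxxx)
  also have "4 * r / \<rho>\<^sup>2 = 1 - (height \<epsilon> x)\<^sup>2"
    unfolding one_minus_height_sq[OF e] \<rho>_def r_def by simp
  also have "\<epsilon> * (1 - 2 * (r * t)) = height \<epsilon> x"
    unfolding height_def r_def t_def \<rho>_def by (simp add: field_simps)
  finally show ?thesis unfolding coord_laplacian_def m_def by (simp add: algebra_simps)
qed

text \<open>The chart formula mentions \<epsilon> only through the height, so both hemispheres give
  the same expression.\<close>

lemma laplacian_height_function:
  assumes p: "p \<in> S2" and W: "\<And>t. t \<in> T \<Longrightarrow> (W has_real_derivative W' t) (at t)"
    and M: "((\<lambda>t. \<psi> t * W' t) has_real_derivative M') (at (p $ 3))"
    and T: "open T" "p $ 3 \<in> T" and f: "\<And>q. q \<in> S2 \<Longrightarrow> q $ 3 \<in> T \<Longrightarrow> f q = W (q $ 3)"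
  shows "laplacian (profile_metric \<psi> \<kappa>) f p
    = 2 * p $ 3 * (\<psi> (p $ 3) * W' (p $ 3)) - (1 - (p $ 3)\<^sup>2) * M'"
proof -
  define \<epsilon> x where "\<epsilon> = hemisphere p" and "x = chart \<epsilon> p"
  have e: "\<epsilon> \<in> {1, -1}" by (simp add: \<epsilon>_def hemisphere_def)
  \<comment> \<open>The chart of the hemisphere of \<open>p\<close> misses only the opposite
    pole.\<close>
  have "p \<noteq> vector [0, 0, - \<epsilon>]"
  proof
    assume "p = vector [0, 0, - \<epsilon>]"
    then have "p $ 3 = - \<epsilon>" by simp
    then show False by (auto simp: \<epsilon>_def hemisphere_def split: if_splits)
  qed
  then have "stereo \<epsilon> x = p" unfolding x_def using e p by (intro stereo_chart)
  then have h: "height \<epsilon> x = p $ 3" by (metis stereo_nth(3))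
  have "f (stereo \<epsilon> y) = W (height \<epsilon> y)" if "height \<epsilon> y \<in> T" for y
    using f[OF stereo_in_S2[OF e]] that by (simp add: stereo_nth)
  then show ?thesis
    using coord_laplacian_height_function[OF e W, of T M' x "\<lambda>y. f (stereo \<epsilon> y)"] M T
    by (simp add: laplacian_def Let_def flip: \<epsilon>_def x_def) (simp add: h)
qed

end

section \<open>The eigenvalue gap in the height coordinate\<close>

text \<open>Since \<open>(1 - z\<^sup>2) G\<close> has derivative \<open>- c U\<close> and \<open>U' = Q\<close>, the polynomial \<open>U\<close> solves the
  eigenvalue equation \<open>((1 - z\<^sup>2) (G / Q) U')' = - c U\<close>; the zeros of \<open>H\<close> make \<open>G / Q\<close> agree with
  the round profile \<open>1\<close> to second order at the poles.\<close>

locale eigen_profile =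
  fixes Q G H U :: "real poly" and c :: real
  assumes Q_pos: "\<bar>z\<bar> \<le> 1 \<Longrightarrow> poly Q z > 0"
    and G_pos: "\<bar>z\<bar> \<le> 1 \<Longrightarrow> poly G z > 0"
    and Q_eq: "Q = G + [:1, 0, -1:] * H"
    and H_poles: "poly H 1 = 0" "poly H (-1) = 0"
    and pderiv_U: "pderiv U = Q"
    and pderiv_flux: "pderiv ([:1, 0, -1:] * G) = smult (-c) U"
begin

lemma flux_deriv:
  "((\<lambda>z. (1 - z\<^sup>2) * poly G z) has_real_derivative - c * poly U z) (at z)"
proof -
  have "poly ([:1, 0, -1:] * G) = (\<lambda>z. (1 - z\<^sup>2) * poly G z)"
    by (simp add: fun_eq_iff algebra_simps power2_eq_square)
  then show ?thesis using poly_DERIV[of "[:1, 0, -1:] * G" z] unfolding pderiv_flux by simp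
qed

text \<open>With \<open>F = (1 - z\<^sup>2) G\<close>, \<open>h = v' / Q\<close> and \<open>q = c U h - \<nu> v\<close>, the function \<open>E = F h q\<close>
  has derivative \<open>q\<^sup>2 + (c - \<nu>) F Q h\<^sup>2 \<ge> 0\<close> and vanishes at both poles.\<close>

lemma no_small_eigenvalue:
  fixes v v' :: "real \<Rightarrow> real"
  assumes v: "\<And>z. \<bar>z\<bar> < 1 \<Longrightarrow> (v has_real_derivative v' z) (at z)"
    and ode: "\<And>z. \<bar>z\<bar> < 1 \<Longrightarrow>
      ((\<lambda>z. (1 - z\<^sup>2) * (poly G z / poly Q z * v' z)) has_real_derivative - \<nu> * v z) (at z)"
    and left: "((\<lambda>z. (1 - z\<^sup>2) * (v' z)\<^sup>2) \<longlongrightarrow> 0) (at_right (-1))"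
    and right: "((\<lambda>z. (1 - z\<^sup>2) * (v' z)\<^sup>2) \<longlongrightarrow> 0) (at_left 1)"
    and bdd: "\<And>z. \<bar>z\<bar> < 1 \<Longrightarrow> \<bar>v z\<bar> \<le> B"
    and \<nu>: "\<nu> < c" and z: "\<bar>z\<bar> < 1"
  shows "v' z = 0"
proof -
  define F where "F z = (1 - z\<^sup>2) * poly G z" for z
  define h where "h z = v' z / poly Q z" for z
  define q where "q z = c * poly U z * h z - \<nu> * v z" for z
  define E where "E z = F z * h z * q z" for z
  have Qn: "poly Q z \<noteq> 0" if "\<bar>z\<bar> < 1" for z using Q_pos[of z] that by simp
  have F_pos: "F z > 0" if "\<bar>z\<bar> < 1" for z
    unfolding F_def using that G_pos[of z] by (intro mult_pos_pos) (auto simp: abs_square_less_1)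
  have Fh: "((\<lambda>z. F z * h z) has_real_derivative - \<nu> * v z) (at z)" if "\<bar>z\<bar> < 1" for z
    using ode[OF that] by (simp add: F_def h_def mult_ac)
  have F: "(F has_real_derivative - c * poly U z) (at z)" for z
    unfolding F_def by (rule flux_deriv)
  have op: "open {z::real. \<bar>z\<bar> < 1}"
    by (intro open_Collect_less continuous_intros)
  \<comment> \<open>Only the flux F h is known to be differentiable, not \<open>v'\<close>, so
    \<open>h\<close> is differentiated as the quotient of F h by F.\<close>
  have h: "(h has_real_derivative q z / F z) (at z)" if z: "\<bar>z\<bar> < 1" for z
  proof -
    have "((\<lambda>z. F z * h z / F z) has_real_derivative
        (- \<nu> * v z * F z - F z * h z * (- c * poly U z)) / (F z * F z)) (at z)"
      using F_pos[OF z] by (intro DERIV_divide Fh[OF z] F) simp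
    also have "(- \<nu> * v z * F z - F z * h z * (- c * poly U z)) / (F z * F z) = q z / F z"
      using F_pos[OF z] by (simp add: q_def field_simps)
    finally show ?thesis
      by (rule has_field_derivative_transform_within_open[OF _ op]) (use z F_pos in fastforce)+
  qed
  have E: "(E has_real_derivative (q z)\<^sup>2 + (c - \<nu>) * F z * poly Q z * (h z)\<^sup>2) (at z)"
    if z: "\<bar>z\<bar> < 1" for z
  proof -
    have "(q has_real_derivative c * (poly Q z * h z + q z / F z * poly U z) - \<nu> * v' z) (at z)"
    proof -
      have "((\<lambda>z. c * (poly U z * h z) - \<nu> * v z) has_real_derivative
          c * (poly Q z * h z + q z / F z * poly U z) - \<nu> * v' z) (at z)"
        using poly_DERIV[of U z] by (intro DERIV_diff DERIV_cmult DERIV_mult h v z) (simp add: pderiv_U)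
      moreover have "q = (\<lambda>z. c * (poly U z * h z) - \<nu> * v z)"
        by (simp add: fun_eq_iff q_def)
      ultimately show ?thesis by (simp only:)
    qed
    \<comment> \<open>\<open>E\<close> is split as the flux F h times \<open>q\<close>, both with
      known derivatives.\<close>
    from DERIV_mult[OF Fh[OF z] this]
    have "(E has_real_derivative - \<nu> * v z * q z
        + (c * (poly Q z * h z + q z / F z * poly U z) - \<nu> * v' z) * (F z * h z)) (at z)"
      unfolding E_def .
    moreover have "- \<nu> * v z * q z
        + (c * (poly Q z * h z + q z / F z * poly U z) - \<nu> * v' z) * (F z * h z)
        = (q z)\<^sup>2 + (c - \<nu>) * F z * poly Q z * (h z)\<^sup>2"
    proof -
      have a: "v' z = poly Q z * h z" "\<nu> * v z = c * poly U z * h z - q z"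
        using Qn[OF z] by (simp_all add: h_def q_def)
      have b: "q z / F z * poly U z * (F z * h z) = q z * poly U z * h z"
        using F_pos[OF z] by simp
      have "- \<nu> * v z * q z + (c * (poly Q z * h z + q z / F z * poly U z) - \<nu> * v' z) * (F z * h z)
          = - (\<nu> * v z) * q z + c * (poly Q z * h z * (F z * h z))
            + c * (q z / F z * poly U z * (F z * h z)) - \<nu> * v' z * (F z * h z)"
        by (simp only: algebra_simps mult_minus_left mult_minus_right)
      then show ?thesis unfolding a b by (simp add: algebra_simps power2_eq_square)
    qed
    ultimately show ?thesis by simp
  qed
  have E_deriv_nonneg: "(q z)\<^sup>2 + (c - \<nu>) * F z * poly Q z * (h z)\<^sup>2 \<ge> 0" if "\<bar>z\<bar> < 1" for z
    using F_pos[OF that] Q_pos[of z] that \<nu> by (intro add_nonneg_nonneg mult_nonneg_nonneg) auto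
  have E_mono: "E x \<le> E y" if "-1 < x" "x \<le> y" "y < 1" for x y
    using that by (intro DERIV_nonneg_imp_nondecreasing[OF that(2)])
      (metis E E_deriv_nonneg abs_less_iff le_less_trans less_le_trans minus_less_iff)
  \<comment> \<open>The limit hypothesis gives F h^2 -> 0. Then (F h)^2 = F (F h^2) -> 0 as well,
    and boundedness of \<open>v\<close> disposes of the term \<nu> v F h.\<close>
  have E_lim: "(E \<longlongrightarrow> 0) (at s within S)"
    if lim: "((\<lambda>z. (1 - z\<^sup>2) * (v' z)\<^sup>2) \<longlongrightarrow> 0) (at s within S)" and s: "\<bar>s\<bar> = 1"
      and ev: "eventually (\<lambda>z. \<bar>z\<bar> < 1) (at s within S)" for s S
  proof -
    have Qs: "poly Q s \<noteq> 0" using Q_pos[of s] s by simp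
    have "s\<^sup>2 = 1" using s by (simp add: abs_square_eq_1)
    have Fs: "(F \<longlongrightarrow> 0) (at s within S)"
      unfolding F_def by (rule tendsto_eq_intros refl)+ (simp add: \<open>s\<^sup>2 = 1\<close>)
    have "((\<lambda>z. (1 - z\<^sup>2) * (v' z)\<^sup>2 * (poly G z / (poly Q z)\<^sup>2)) \<longlongrightarrow> 0 * (poly G s / (poly Q s)\<^sup>2))
        (at s within S)"
      using Qs by (intro tendsto_intros lim) auto
    moreover have "(1 - z\<^sup>2) * (v' z)\<^sup>2 * (poly G z / (poly Q z)\<^sup>2) = F z * (h z)\<^sup>2" for z
      by (simp add: F_def h_def power_divide)
    ultimately have Fh2: "((\<lambda>z. F z * (h z)\<^sup>2) \<longlongrightarrow> 0) (at s within S)" by simp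
    have "((\<lambda>z. F z * (F z * (h z)\<^sup>2)) \<longlongrightarrow> 0) (at s within S)"
      using tendsto_mult[OF Fs Fh2] by simp
    then have "((\<lambda>z. (F z * h z)\<^sup>2) \<longlongrightarrow> 0) (at s within S)"
      by (simp add: power2_eq_square mult_ac)
    then have Fh0: "((\<lambda>z. F z * h z) \<longlongrightarrow> 0) (at s within S)"
      using tendsto_real_sqrt by fastforce
    have "((\<lambda>z. v z * (F z * h z)) \<longlongrightarrow> 0) (at s within S)"
    proof (rule Lim_null_comparison)
      show "((\<lambda>z. B * \<bar>F z * h z\<bar>) \<longlongrightarrow> 0) (at s within S)"
        using tendsto_mult[OF tendsto_const tendsto_rabs_zero[OF Fh0]] by simp
      show "eventually (\<lambda>z. norm (v z * (F z * h z)) \<le> B * \<bar>F z * h z\<bar>) (at s within S)"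
        using ev by eventually_elim (auto simp: abs_mult intro!: mult_right_mono bdd)
    qed
    then have "((\<lambda>z. c * poly U z * (F z * (h z)\<^sup>2) - \<nu> * (v z * (F z * h z))) \<longlongrightarrow>
        c * poly U s * 0 - \<nu> * 0) (at s within S)"
      by (intro tendsto_intros Fh2)
    moreover have "c * poly U z * (F z * (h z)\<^sup>2) - \<nu> * (v z * (F z * h z)) = E z" for z
      by (simp add: E_def q_def algebra_simps power2_eq_square)
    ultimately show ?thesis by simp
  qed
  \<comment> \<open>A nondecreasing function with limit 0 at both ends of the interval is 0.\<close>
  have E0: "E x = 0" if x: "\<bar>x\<bar> < 1" for x
  proof (rule antisym)
    have x': "-1 < x" "x < 1" using x by auto
    have ev: "eventually (\<lambda>z. \<bar>z\<bar> < (1::real)) (at_left 1)"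
      using eventually_at_left_real[of 0 1] by (auto elim: eventually_mono)
    show "E x \<le> 0"
    proof (rule tendsto_lowerbound[OF E_lim[OF right _ ev]])
      show "eventually (\<lambda>y. E x \<le> E y) (at_left 1)"
        using eventually_at_left_real[OF x'(2)] x' by (auto elim!: eventually_mono intro!: E_mono)
    qed auto
    have ev: "eventually (\<lambda>z. \<bar>z\<bar> < (1::real)) (at_right (-1))"
      using eventually_at_right_real[of "-1" 0] by (auto elim: eventually_mono)
    show "E x \<ge> 0"
    proof (rule tendsto_upperbound[OF E_lim[OF left _ ev]])
      show "eventually (\<lambda>y. E y \<le> E x) (at_right (-1))"
        using eventually_at_right_real[OF x'(1)] x' by (auto elim!: eventually_mono intro!: E_mono)
    qed auto
  qed
  \<comment> \<open>Both nonnegative terms in the derivative of \<open>E\<close> must vanish; the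
    coefficient of h^2 is strictly positive because \<nu> < c.\<close>
  have "(E has_real_derivative 0) (at z)"
    by (rule has_field_derivative_transform_within_open[OF DERIV_const op, of z 0]) (use z E0 in auto)
  then have "(q z)\<^sup>2 + (c - \<nu>) * F z * poly Q z * (h z)\<^sup>2 = 0"
    using DERIV_unique E[OF z] by blast
  moreover have "(c - \<nu>) * F z * poly Q z > 0"
    using F_pos[OF z] Q_pos[of z] z \<nu> by (intro mult_pos_pos) auto
  then have "(c - \<nu>) * F z * poly Q z * (h z)\<^sup>2 > 0 \<or> h z = 0" by auto
  ultimately have "h z = 0" using zero_le_power2[of "q z"] by linarith
  then show ?thesis using Qn[OF z] by (simp add: h_def)
qed

end

section \<open>Invariant functions as functions of the height\<close>

lemma sphere_meridian:
  assumes "p \<in> S2"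
  obtains \<theta> where "p = rotate \<theta> (vector [sqrt (1 - (p $ 3)\<^sup>2), 0, p $ 3])"
proof -
  define R where "R = sqrt (1 - (p $ 3)\<^sup>2)"
  have p: "(p $ 1)\<^sup>2 + (p $ 2)\<^sup>2 = 1 - (p $ 3)\<^sup>2" using assms norm3_sq[of p] by simp
  then have "1 - (p $ 3)\<^sup>2 \<ge> 0" by (metis add_nonneg_nonneg zero_le_power2)
  then have R: "R\<^sup>2 = (p $ 1)\<^sup>2 + (p $ 2)\<^sup>2" "R \<ge> 0" by (simp_all add: R_def p)
  obtain \<theta> where "p $ 1 = R * cos \<theta>" "p $ 2 = R * sin \<theta>"
  proof (cases "R = 0")
    case True
    then show ?thesis using R(1) that[of 0] by (simp add: sum_power2_eq_zero_iff)
  next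
    case False
    have "(p $ 1 / R)\<^sup>2 + (p $ 2 / R)\<^sup>2 = ((p $ 1)\<^sup>2 + (p $ 2)\<^sup>2) / R\<^sup>2"
      by (simp add: power_divide add_divide_distrib)
    also have "\<dots> = 1" using False by (simp flip: R(1))
    finally have "(p $ 1 / R)\<^sup>2 + (p $ 2 / R)\<^sup>2 = 1" .
    then obtain t where "p $ 1 / R = cos t" "p $ 2 / R = sin t" by (rule sincos_total_2pi)
    then show ?thesis using False that[of t] by (simp add: field_simps)
  qed
  then have "p = rotate \<theta> (vector [R, 0, p $ 3])"
    by (simp add: rotate_def vec_eq_iff forall_3 mult.commute)
  then show ?thesis using that unfolding R_def by blast
qed

lemma meridian_in_S2: "\<bar>z\<bar> \<le> 1 \<Longrightarrow> (vector [sqrt (1 - z\<^sup>2), 0, z] :: real^3) \<in> S2"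
  by (simp add: norm_eq_sqrt_inner inner_3 abs_square_le_1 flip: power2_eq_square)

text \<open>Every orbit of the rotation meets the chosen meridian.\<close>

lemma S1_invariant_fun_height:
  assumes "S1_invariant_fun f" "p \<in> S2"
  shows "f p = f (vector [sqrt (1 - (p $ 3)\<^sup>2), 0, p $ 3])"
proof -
  have "(p $ 1)\<^sup>2 + (p $ 2)\<^sup>2 + (p $ 3)\<^sup>2 = 1" using assms(2) norm3_sq[of p] by simp
  then have "(p $ 3)\<^sup>2 \<le> 1" using zero_le_power2[of "p $ 1"] zero_le_power2[of "p $ 2"] by linarith
  then have "(vector [sqrt (1 - (p $ 3)\<^sup>2), 0, p $ 3] :: real^3) \<in> S2"
    by (intro meridian_in_S2) (simp add: abs_square_le_1)
  with assms sphere_meridian[OF assms(2)] show ?thesis unfolding S1_invariant_fun_def by metis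
qed

text \<open>The nonnegative solution r of \<epsilon> (1 - r^2) / (1 + r^2) = z: the radius, in the
  chart, of the parallel at height z.\<close>

definition chart_radius :: "real \<Rightarrow> real \<Rightarrow> real" where
  "chart_radius \<epsilon> z = sqrt ((1 - \<epsilon> * z) / (1 + \<epsilon> * z))"

lemma sign_mult_bounds:
  assumes "\<epsilon> \<in> {1, -1 :: real}" "\<bar>z\<bar> < 1"
  shows "1 - \<epsilon> * z > 0" "1 + \<epsilon> * z > 0"
  using assms by auto

lemma chart_radius_sq:
  assumes "\<epsilon> \<in> {1, -1}" "\<bar>z\<bar> < 1"
  shows "(chart_radius \<epsilon> z)\<^sup>2 = (1 - \<epsilon> * z) / (1 + \<epsilon> * z)" "chart_radius \<epsilon> z > 0"
  using sign_mult_bounds[OF assms] by (simp_all add: chart_radius_def)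

lemma height_chart_radius:
  assumes "\<epsilon> \<in> {1, -1}" "\<bar>z\<bar> < 1"
  shows "height \<epsilon> (chart_radius \<epsilon> z *\<^sub>R axis 1 1) = z"
proof -
  have e: "\<epsilon> * (\<epsilon> * z) = z" "\<epsilon> * \<epsilon> = 1" using assms(1) by auto
  show ?thesis
    using sign_mult_bounds[OF assms]
    by (simp add: height_def power_mult_distrib chart_radius_sq[OF assms] divide_simps)
      (simp add: algebra_simps e)
qed

lemma chart_radius_deriv:
  assumes "\<epsilon> \<in> {1, -1}" "\<bar>z\<bar> < 1"
  shows "(chart_radius \<epsilon> has_real_derivative - \<epsilon> / ((1 + \<epsilon> * z)\<^sup>2 * chart_radius \<epsilon> z)) (at z)"
proof -
  note b = sign_mult_bounds[OF assms]
  have "((\<lambda>z. (1 - \<epsilon> * z) / (1 + \<epsilon> * z)) has_real_derivative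
      (- \<epsilon> * (1 + \<epsilon> * z) - (1 - \<epsilon> * z) * \<epsilon>) / ((1 + \<epsilon> * z) * (1 + \<epsilon> * z))) (at z)"
    using b by (auto intro!: derivative_eq_intros)
  moreover have "- \<epsilon> * (1 + \<epsilon> * z) - (1 - \<epsilon> * z) * \<epsilon> = - 2 * \<epsilon>" by (simp add: algebra_simps)
  ultimately have "((\<lambda>z. (1 - \<epsilon> * z) / (1 + \<epsilon> * z)) has_real_derivative - 2 * \<epsilon> / (1 + \<epsilon> * z)\<^sup>2) (at z)"
    by (simp only: power2_eq_square)
  from DERIV_chain2[OF DERIV_real_sqrt this]
  have "(chart_radius \<epsilon> has_real_derivative
      inverse (chart_radius \<epsilon> z) / 2 * (- 2 * \<epsilon> / (1 + \<epsilon> * z)\<^sup>2)) (at z)"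
    using b unfolding chart_radius_def by simp
  then show ?thesis by (simp add: field_simps)
qed

lemma deriv_along_meridian:
  assumes e: "\<epsilon> \<in> {1, -1}" and z: "\<bar>z\<bar> < 1" and V: "smooth V"
  shows "((\<lambda>z. V (chart_radius \<epsilon> z *\<^sub>R axis 1 1)) has_real_derivative
     partial 1 V (chart_radius \<epsilon> z *\<^sub>R axis 1 1) * (- \<epsilon> / ((1 + \<epsilon> * z)\<^sup>2 * chart_radius \<epsilon> z))) (at z)"
proof -
  obtain V' where V': "(V has_derivative V') (at (chart_radius \<epsilon> z *\<^sub>R axis 1 1))"
    using smooth_differentiable[OF V] by (auto simp: differentiable_def)
  have "((\<lambda>z. chart_radius \<epsilon> z *\<^sub>R axis 1 (1::real) :: real^2) has_derivative
      (\<lambda>d. ((- \<epsilon> / ((1 + \<epsilon> * z)\<^sup>2 * chart_radius \<epsilon> z)) * d) *\<^sub>R axis 1 1)) (at z)"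
    using chart_radius_deriv[OF e z] unfolding has_field_derivative_def by (rule has_derivative_scaleR_left)
  from has_derivative_compose[OF this V']
  have "((\<lambda>z. V (chart_radius \<epsilon> z *\<^sub>R axis 1 1)) has_derivative
      (\<lambda>d. V' (((- \<epsilon> / ((1 + \<epsilon> * z)\<^sup>2 * chart_radius \<epsilon> z)) * d) *\<^sub>R axis 1 1))) (at z)" .
  moreover have *: "V' (k *\<^sub>R axis 1 1) = k * partial 1 V (chart_radius \<epsilon> z *\<^sub>R axis 1 1)" for k
    unfolding partial_eq[OF V'] linear_simps(5)[OF has_derivative_bounded_linear[OF V']] by simp
  ultimately show ?thesis unfolding has_field_derivative_def * by (simp only: mult_ac mult_commute_abs)
qed

text \<open>The differential of an even function at 0 is both even and linear. In a chart centred at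
  a pole, this tames the factor 1/r that appears when differentiating with respect to the
  height.\<close>

lemma partial_even_zero:
  assumes V: "smooth V" and even: "\<And>x. V (- x) = V x"
  shows "partial i V 0 = 0"
proof -
  obtain V' where V': "(V has_derivative V') (at 0)"
    using smooth_differentiable[OF V] by (auto simp: differentiable_def)
  have "((\<lambda>x. V (- x)) has_derivative (\<lambda>d. V' (- d))) (at 0)"
    by (rule has_derivative_compose[of uminus uminus 0 UNIV V V'])
      (use V' has_derivative_minus[OF has_derivative_ident] in auto)
  then have "partial i V 0 = V' (- axis i 1)" by (simp add: even partial_eq)
  also have "\<dots> = - V' (axis i 1)" using has_derivative_linear[OF V'] by (simp add: linear_neg)
  finally show ?thesis using partial_eq[OF V', of i] by simp
qed

lemma S1_invariant_fun_chart:
  assumes "S1_invariant_fun f" "\<epsilon> \<in> {1, -1}"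
  shows "f (stereo \<epsilon> x) = f (vector [sqrt (1 - (height \<epsilon> x)\<^sup>2), 0, height \<epsilon> x])"
  using S1_invariant_fun_height[OF assms(1) stereo_in_S2[OF assms(2)]] by (simp add: stereo_nth)

text \<open>This supplies the limit and boundedness hypotheses of
  \<open>no_small_eigenvalue\<close>. Near the pole \<epsilon>, (1 - z^2) (W')^2 is the square of P
  / (1 + \<epsilon> z), with \<open>P\<close> a partial derivative in the chart that vanishes at the
  pole.\<close>

lemma S1_invariant_fun_profile:
  assumes inv: "S1_invariant_fun f" and sm: "smooth_on_S2 f"
  obtains W W' W'' B where
    "\<And>p. p \<in> S2 \<Longrightarrow> f p = W (p $ 3)"
    "\<And>z. \<bar>z\<bar> < 1 \<Longrightarrow> (W has_real_derivative W' z) (at z)"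
    "\<And>z. \<bar>z\<bar> < 1 \<Longrightarrow> (W' has_real_derivative W'' z) (at z)"
    "((\<lambda>z. (1 - z\<^sup>2) * (W' z)\<^sup>2) \<longlongrightarrow> 0) (at_right (-1))"
    "((\<lambda>z. (1 - z\<^sup>2) * (W' z)\<^sup>2) \<longlongrightarrow> 0) (at_left 1)"
    "\<And>z. \<bar>z\<bar> < 1 \<Longrightarrow> \<bar>W z\<bar> \<le> B"
proof -
  define W where "W z = f (vector [sqrt (1 - z\<^sup>2), 0, z])" for z
  define V where "V \<epsilon> x = f (stereo \<epsilon> x)" for \<epsilon> x
  define P where "P \<epsilon> z = partial 1 (V \<epsilon>) (chart_radius \<epsilon> z *\<^sub>R axis 1 1)" for \<epsilon> z
  define W' where "W' z = P 1 z * (- 1 / ((1 + z)\<^sup>2 * chart_radius 1 z))" for z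
  have V: "smooth (V \<epsilon>)" if "\<epsilon> \<in> {1, -1}" for \<epsilon>
    using sm that unfolding smooth_on_S2_def V_def by blast
  have VW: "V \<epsilon> x = W (height \<epsilon> x)" if "\<epsilon> \<in> {1, -1}" for \<epsilon> x
    unfolding V_def W_def by (rule S1_invariant_fun_chart[OF inv that])
  have op: "open {z::real. \<bar>z\<bar> < 1}" by (intro open_Collect_less continuous_intros)
  have dW: "(W has_real_derivative P \<epsilon> z * (- \<epsilon> / ((1 + \<epsilon> * z)\<^sup>2 * chart_radius \<epsilon> z))) (at z)"
    if e: "\<epsilon> \<in> {1, -1}" and z: "\<bar>z\<bar> < 1" for \<epsilon> z
    unfolding P_def
    by (rule has_field_derivative_transform_within_open[OF deriv_along_meridian[OF e z V[OF e]] op])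
      (use z VW[OF e] height_chart_radius[OF e] in auto)
  \<comment> \<open>\<open>W'\<close> is defined through the north chart; uniqueness of derivatives
    gives its south chart form, needed for the limit at -1.\<close>
  have W'_eq: "W' z = P \<epsilon> z * (- \<epsilon> / ((1 + \<epsilon> * z)\<^sup>2 * chart_radius \<epsilon> z))"
    if "\<epsilon> \<in> {1, -1}" "\<bar>z\<bar> < 1" for \<epsilon> z
    using DERIV_unique[OF dW[OF that] dW[OF _ that(2), of 1]] by (simp add: W'_def)
  have W': "\<exists>D. (W' has_real_derivative D) (at z)" if z: "\<bar>z\<bar> < 1" for z
  proof -
    have "1 + z \<noteq> 0" "chart_radius 1 z \<noteq> 0" using z chart_radius_sq(2)[of 1 z] by auto
    then have "\<exists>D. ((\<lambda>z. - 1 / ((1 + z)\<^sup>2 * chart_radius 1 z)) has_real_derivative D) (at z)"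
      using chart_radius_deriv[of 1 z] z by (intro exI) (auto intro!: derivative_eq_intros)
    moreover have "\<exists>D. (P 1 has_real_derivative D) (at z)"
      unfolding P_def using deriv_along_meridian[OF _ z smooth_partial[OF V]] by blast
    ultimately show ?thesis unfolding W'_def using DERIV_mult by blast
  qed
  have limit: "((\<lambda>z. (1 - z\<^sup>2) * (W' z)\<^sup>2) \<longlongrightarrow> 0) (at \<epsilon> within S)"
    if e: "\<epsilon> \<in> {1, -1}" and ev: "eventually (\<lambda>z. \<bar>z\<bar> < 1) (at \<epsilon> within S)" for \<epsilon> S
  proof -
    have ee: "\<epsilon> * \<epsilon> = 1" "1 + \<epsilon> * \<epsilon> \<noteq> 0" using e by auto
    have "((\<lambda>z. chart_radius \<epsilon> z) \<longlongrightarrow> sqrt ((1 - \<epsilon> * \<epsilon>) / (1 + \<epsilon> * \<epsilon>))) (at \<epsilon> within S)"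
      unfolding chart_radius_def by (intro tendsto_intros ee)
    then have "((\<lambda>z. chart_radius \<epsilon> z *\<^sub>R axis 1 1 :: real^2) \<longlongrightarrow> 0 *\<^sub>R axis 1 1) (at \<epsilon> within S)"
      by (intro tendsto_scaleR tendsto_const) (simp add: ee)
    then have "((\<lambda>z. P \<epsilon> z) \<longlongrightarrow> partial 1 (V \<epsilon>) 0) (at \<epsilon> within S)"
      unfolding P_def by (intro isCont_tendsto_compose[OF smooth_isCont[OF smooth_partial[OF V[OF e]]]]) simp
    also have "partial 1 (V \<epsilon>) 0 = 0"
      by (rule partial_even_zero[OF V[OF e]]) (simp add: VW[OF e] height_def)
    finally have "((\<lambda>z. (P \<epsilon> z / (1 + \<epsilon> * z))\<^sup>2) \<longlongrightarrow> (0 / (1 + \<epsilon> * \<epsilon>))\<^sup>2) (at \<epsilon> within S)"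
      by (intro tendsto_intros ee)
    then have "((\<lambda>z. (P \<epsilon> z / (1 + \<epsilon> * z))\<^sup>2) \<longlongrightarrow> 0) (at \<epsilon> within S)" by simp
    moreover have "eventually (\<lambda>z. (P \<epsilon> z / (1 + \<epsilon> * z))\<^sup>2 = (1 - z\<^sup>2) * (W' z)\<^sup>2) (at \<epsilon> within S)"
      using ev
    proof eventually_elim
      case (elim z)
      note b = sign_mult_bounds[OF e elim]
      have "1 - z\<^sup>2 = (1 - \<epsilon> * z) * (1 + \<epsilon> * z)"
        using e by (auto simp: power2_eq_square algebra_simps)
      moreover have "(W' z)\<^sup>2 = (P \<epsilon> z)\<^sup>2 * (\<epsilon>\<^sup>2 / (((1 + \<epsilon> * z)\<^sup>2)\<^sup>2 * (chart_radius \<epsilon> z)\<^sup>2))"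
        unfolding W'_eq[OF e elim] by (simp add: power_mult_distrib power_divide)
      moreover have "a\<^sup>2 / (y\<^sup>2) = x * y * (a\<^sup>2 * (1 / ((y\<^sup>2)\<^sup>2 * (x / y))))" if "x > 0" "y > 0" for a x y :: real
        using that by (simp add: field_simps power2_eq_square)
      ultimately show ?case
        using b ee(1) by (simp add: chart_radius_sq[OF e elim] power_divide power2_eq_square[of \<epsilon>])
    qed
    ultimately show ?thesis by (rule Lim_transform_eventually)
  qed
  \<comment> \<open>The closed unit disc of each chart is compact and covers its closed hemisphere,
    so two such bounds control \<open>W\<close>.\<close>
  have bdd: "\<exists>B. \<forall>x\<in>cball 0 1. \<bar>V \<epsilon> x\<bar> \<le> B" if e: "\<epsilon> \<in> {1, -1}" for \<epsilon>
  proof -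
    have "compact (V \<epsilon> ` cball 0 1)"
      using smooth_isCont[OF V[OF e]] by (intro compact_continuous_image continuous_at_imp_continuous_on) auto
    then show ?thesis using compact_imp_bounded[THEN bounded_pos[THEN iffD1]] by fastforce
  qed
  obtain B1 where B1: "\<And>x. norm x \<le> 1 \<Longrightarrow> \<bar>V 1 x\<bar> \<le> B1" using bdd[of 1] by (metis insertI1 mem_cball_0)
  obtain B2 where B2: "\<And>x. norm x \<le> 1 \<Longrightarrow> \<bar>V (-1) x\<bar> \<le> B2" using bdd[of "-1"] by (metis insertI1 insertI2 mem_cball_0)
  have Wb: "\<bar>W z\<bar> \<le> max B1 B2" if z: "\<bar>z\<bar> < 1" for z
  proof -
    have *: "W z = V \<epsilon> (chart_radius \<epsilon> z *\<^sub>R axis 1 1)" "norm (chart_radius \<epsilon> z *\<^sub>R axis 1 1 :: real^2) \<le> 1"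
      if "\<epsilon> \<in> {1, -1}" "\<epsilon> * z \<ge> 0" for \<epsilon>
    proof -
      show "W z = V \<epsilon> (chart_radius \<epsilon> z *\<^sub>R axis 1 1)"
        using VW[OF that(1)] height_chart_radius[OF that(1) z] by simp
      have "chart_radius \<epsilon> z \<le> 1"
        unfolding chart_radius_def using that(2) by (simp add: divide_simps)
      then show "norm (chart_radius \<epsilon> z *\<^sub>R axis 1 1 :: real^2) \<le> 1"
        using chart_radius_sq(2)[OF that(1) z] by simp
    qed
    show ?thesis using *[of 1] *[of "-1"] B1 B2 by (cases "z \<ge> 0") (force simp: le_max_iff_disj)+
  qed
  obtain W'' where W'': "\<And>z. \<bar>z\<bar> < 1 \<Longrightarrow> (W' has_real_derivative W'' z) (at z)"
    using W' by metis
  have evl: "eventually (\<lambda>z. \<bar>z\<bar> < (1::real)) (at_left 1)"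
    using eventually_at_left_real[of 0 1] by (auto elim: eventually_mono)
  have evr: "eventually (\<lambda>z. \<bar>z\<bar> < (1::real)) (at_right (-1))"
    using eventually_at_right_real[of "-1" 0] by (auto elim: eventually_mono)
  show ?thesis
  proof (rule that[of W W' W'' "max B1 B2"])
    show "f p = W (p $ 3)" if "p \<in> S2" for p
      unfolding W_def by (rule S1_invariant_fun_height[OF inv that])
    show "(W has_real_derivative W' z) (at z)" if "\<bar>z\<bar> < 1" for z
      using dW[OF _ that, of 1] by (simp add: W'_def)
  qed (use W'' limit[OF _ evl] limit[OF _ evr] Wb in auto)
qed

section \<open>Curvature at the poles\<close>

text \<open>The derivative of \<open>e\<close> would be multiplied by g x = 0, so continuity of
  \<open>e\<close> suffices. The Christoffel symbols at the origin are differentiated this way, with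
  only first derivatives of the metric coefficients at hand.\<close>

lemma has_derivative_mult_isCont:
  fixes e g :: "'a::real_normed_vector \<Rightarrow> real"
  assumes e: "isCont e x" and g: "(g has_derivative g') (at x)" and 0: "g x = 0"
  shows "((\<lambda>y. e y * g y) has_derivative (\<lambda>d. e x * g' d)) (at x)"
proof -
  interpret g': bounded_linear g' using g by (rule has_derivative_bounded_linear)
  obtain K where K: "\<And>d. norm (g' d) \<le> norm d * K" using g'.bounded by blast
  have g0: "((\<lambda>y. (g y - g' (y - x)) / norm (y - x)) \<longlongrightarrow> 0) (at x)"
    using g 0 by (simp add: has_derivative_at_within divide_inverse_commute)
  have e0: "((\<lambda>y. e y - e x) \<longlongrightarrow> 0) (at x)"
    using e by (simp add: isCont_def LIM_zero)
  have "((\<lambda>y. (e y - e x) * (g' (y - x) / norm (y - x))) \<longlongrightarrow> 0) (at x)"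
  proof (rule Lim_null_comparison)
    show "((\<lambda>y. \<bar>e y - e x\<bar> * K) \<longlongrightarrow> 0) (at x)"
      using tendsto_mult[OF tendsto_rabs_zero[OF e0] tendsto_const] by simp
    have "norm ((e y - e x) * (g' (y - x) / norm (y - x))) \<le> \<bar>e y - e x\<bar> * K" if "y \<noteq> x" for y
      unfolding norm_mult using K[of "y - x"] that
      by (intro mult_mono) (auto simp: field_simps)
    then show "\<forall>\<^sub>F y in at x. norm ((e y - e x) * (g' (y - x) / norm (y - x))) \<le> \<bar>e y - e x\<bar> * K"
      by (auto simp: eventually_at intro!: exI[of _ 1])
  qed
  moreover have "((\<lambda>y. e y * ((g y - g' (y - x)) / norm (y - x))) \<longlongrightarrow> e x * 0) (at x)"
    using e by (intro tendsto_mult g0) (simp add: isCont_def)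
  ultimately have "((\<lambda>y. e y * ((g y - g' (y - x)) / norm (y - x))
      + (e y - e x) * (g' (y - x) / norm (y - x))) \<longlongrightarrow> e x * 0 + 0) (at x)"
    by (intro tendsto_add)
  moreover have "e y * ((g y - g' (y - x)) / norm (y - x)) + (e y - e x) * (g' (y - x) / norm (y - x))
      = (e y * g y - e x * g x - e x * g' (y - x)) / norm (y - x)" for y
    by (simp add: 0 add_divide_distrib[symmetric] diff_divide_distrib[symmetric] algebra_simps)
  ultimately show ?thesis
    by (simp add: has_derivative_at_within divide_inverse_commute bounded_linear_mult_right
        bounded_linear_compose[OF bounded_linear_mult_right g'.bounded_linear_axioms])
qed

lemma matrix_inv_2:
  fixes A :: "real^2^2"
  assumes "det A \<noteq> 0"
  shows "matrix_inv A $ i $ j = (if i = j then if i = 1 then A $ 2 $ 2 else A $ 1 $ 1 else - A $ i $ j) / det A"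
proof -
  have "A ** (\<chi> i j. (if i = j then if i = 1 then A $ 2 $ 2 else A $ 1 $ 1 else - A $ i $ j) / det A) = mat 1"
    using assms by (simp add: vec_eq_iff forall_2 matrix_matrix_mult_def sum_2 mat_def)
      (simp add: det_2 diff_divide_distrib[symmetric] add_divide_distrib[symmetric] mult_ac)
  then show ?thesis by (simp add: matrix_inv_unique_2)
qed

text \<open>The first derivatives of \<open>h\<close> vanish at the origin, hence so do the
  Christoffel symbols. Only their derivatives enter the curvature, and these involve just
  \<alpha>(0), \<alpha>'(0) and \<beta>(0).\<close>

lemma coord_gauss_curvature_origin:
  assumes h: "\<And>y i j. h y $ i $ j = \<alpha> ((norm y)\<^sup>2) * axis i 1 $ j + \<beta> ((norm y)\<^sup>2) * (y $ i * y $ j)"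
    and T: "open T" "0 \<in> T"
    and \<alpha>: "\<And>r. r \<in> T \<Longrightarrow> (\<alpha> has_real_derivative \<alpha>' r) (at r)"
    and \<beta>: "\<And>r. r \<in> T \<Longrightarrow> (\<beta> has_real_derivative \<beta>' r) (at r)"
    and c: "isCont \<alpha>' 0" "isCont \<beta>' 0"
    and 0: "\<alpha> 0 \<noteq> 0"
  shows "coord_gauss_curvature h 0 = (\<beta> 0 - 2 * \<alpha>' 0) / (\<alpha> 0)\<^sup>2"
proof -
  define \<delta> :: "2 \<Rightarrow> 2 \<Rightarrow> real" where "\<delta> i j = axis i 1 $ j" for i j
  define S where "S = (\<lambda>y::real^2. (norm y)\<^sup>2) -` T"
  have S: "open S" "0 \<in> S"
    unfolding S_def using T by (auto intro!: continuous_open_vimage continuous_intros)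
  \<comment> \<open>The partials of \<open>h\<close> near 0, grouped so that each term is a
    continuous factor times a linear factor vanishing at 0, as
    \<open>has_derivative_mult_isCont\<close> requires.\<close>
  define Dh where "Dh k i j y = (\<alpha>' ((norm y)\<^sup>2) * \<delta> i j) * (2 * y $ k)
      + (\<beta>' ((norm y)\<^sup>2) * (y $ i * y $ j)) * (2 * y $ k)
      + \<beta> ((norm y)\<^sup>2) * (\<delta> i k * y $ j + \<delta> j k * y $ i)" for i j k and y :: "real^2"
  have comp: "((\<lambda>y::real^2. f ((norm y)\<^sup>2)) has_derivative (\<lambda>d. f' * (2 * (y \<bullet> d)))) (at y)"
    if "(f has_real_derivative f') (at ((norm y)\<^sup>2))" for f f' and y :: "real^2"
    using has_derivative_compose[OF has_derivative_norm_sq that[unfolded has_field_derivative_def]] .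
  have ph: "partial k (\<lambda>y. h y $ i $ j) y = Dh k i j y" if "y \<in> S" for i j k y
  proof -
    have y: "(norm y)\<^sup>2 \<in> T" using that by (simp add: S_def)
    have "((\<lambda>y. h y $ i $ j) has_derivative (\<lambda>d. (\<alpha>' ((norm y)\<^sup>2) * (2 * (y \<bullet> d))) * axis i 1 $ j
        + (\<beta> ((norm y)\<^sup>2) * (y $ i * d $ j + d $ i * y $ j)
        + (\<beta>' ((norm y)\<^sup>2) * (2 * (y \<bullet> d))) * (y $ i * y $ j)))) (at y)"
      unfolding h
      by (intro has_derivative_add has_derivative_mult has_derivative_mult_left has_derivative_nth
          comp \<alpha> \<beta> y)
    from partial_eq[OF this, of k] show ?thesis
      by (simp add: Dh_def \<delta>_def inner_axis_one axis_nth_sym[of k] algebra_simps)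
  qed
  have sq: "isCont (\<lambda>y::real^2. (norm y)\<^sup>2) 0" by (intro continuous_intros)
  have cont: "isCont (\<lambda>y::real^2. f ((norm y)\<^sup>2)) 0" if "isCont f 0" for f :: "real \<Rightarrow> real"
    using isCont_o2[OF sq, of f] that by simp
  have nth: "isCont (\<lambda>y::real^2. y $ i) 0" for i by (intro continuous_intros)
  have c\<alpha>\<beta>: "isCont \<alpha> 0" "isCont \<beta> 0" using \<alpha>[OF T(2)] \<beta>[OF T(2)] by (auto intro: DERIV_isCont)
  have Dh0: "Dh k i j 0 = 0" for k i j by (simp add: Dh_def)
  have dDh: "(Dh k i j has_derivative
      (\<lambda>d. 2 * \<alpha>' 0 * \<delta> i j * d $ k + \<beta> 0 * (\<delta> i k * d $ j + \<delta> j k * d $ i))) (at 0)" for k i j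
  proof -
    have "((\<lambda>y. (\<alpha>' ((norm y)\<^sup>2) * \<delta> i j) * (2 * y $ k)
      + (\<beta>' ((norm y)\<^sup>2) * (y $ i * y $ j)) * (2 * y $ k)
      + \<beta> ((norm y)\<^sup>2) * (\<delta> i k * y $ j + \<delta> j k * y $ i)) has_derivative
      (\<lambda>d. (\<alpha>' ((norm (0::real^2))\<^sup>2) * \<delta> i j) * (2 * d $ k)
      + (\<beta>' ((norm (0::real^2))\<^sup>2) * ((0::real^2) $ i * (0::real^2) $ j)) * (2 * d $ k)
      + \<beta> ((norm (0::real^2))\<^sup>2) * (\<delta> i k * d $ j + \<delta> j k * d $ i))) (at 0)"
      by (intro has_derivative_add[OF has_derivative_add] has_derivative_mult_isCont
          has_derivative_mult_right has_derivative_add[OF has_derivative_mult_right has_derivative_mult_right]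
          has_derivative_nth continuous_mult cont nth c c\<alpha>\<beta> continuous_const) simp_all
    then show ?thesis unfolding Dh_def by (simp add: mult_ac)
  qed
  have h0: "h 0 $ i $ j = \<alpha> 0 * \<delta> i j" for i j by (simp add: h \<delta>_def)
  have \<delta>: "\<delta> 1 1 = 1" "\<delta> 2 2 = 1" "\<delta> 1 2 = 0" "\<delta> 2 1 = 0" by (simp_all add: \<delta>_def axis_def)
  have det0: "det (h 0) = (\<alpha> 0)\<^sup>2" unfolding det_2 h0 \<delta> by (simp add: power2_eq_square)
  have inv0: "matrix_inv (h 0) $ i $ j = \<delta> i j / \<alpha> 0" for i j
    using 0 exhaust_2[of i] exhaust_2[of j]
    by (auto simp: matrix_inv_2 det0 h0 \<delta> power2_eq_square)
  have conth: "isCont (\<lambda>y. h y $ i $ j) 0" for i j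
    unfolding h by (intro continuous_intros cont c\<alpha>\<beta>)
  have contdet: "isCont (\<lambda>y. det (h y)) 0"
    unfolding det_2 by (intro continuous_intros conth)
  \<comment> \<open>The explicit formula for the inverse is available only where the determinant is
    nonzero; continuity needs it on a neighbourhood.\<close>
  have ev: "eventually (\<lambda>y. det (h y) \<noteq> 0) (nhds 0)"
  proof (rule tendsto_imp_eventually_ne)
    show "((\<lambda>y. det (h y)) \<longlongrightarrow> det (h 0)) (nhds 0)"
      using contdet tendsto_at_iff_tendsto_nhds[of "\<lambda>y. det (h y)" 0] by (simp add: isCont_def)
  qed (simp add: det0 0)
  have coninv: "isCont (\<lambda>y. matrix_inv (h y) $ i $ j) 0" for i j
  proof -
    have "isCont (\<lambda>y. (if i = j then if i = 1 then h y $ 2 $ 2 else h y $ 1 $ 1 else - h y $ i $ j) / det (h y)) 0"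
      using conth contdet det0 0
      by (cases "i = j"; cases "i = 1") (auto intro!: continuous_divide continuous_minus)
    then show ?thesis
      by (rule isCont_cong[THEN iffD2, rotated]) (use ev in \<open>auto elim!: eventually_mono simp: matrix_inv_2\<close>)
  qed
  have chr: "christoffel h k i j y = (\<Sum>l\<in>UNIV. matrix_inv (h y) $ k $ l * (Dh i j l y + Dh j i l y - Dh l i j y)) / 2"
    if "y \<in> S" for k i j y
    unfolding christoffel_def using that by (simp add: ph)
  have chr0: "christoffel h k i j 0 = 0" for k i j
    using chr[OF S(2)] by (simp add: Dh0)
  \<comment> \<open>The second partial of the entry (i, j) of \<open>h\<close> at 0, in the
    directions k and m.\<close>
  define DD where "DD m k i j = 2 * \<alpha>' 0 * \<delta> i j * \<delta> m k + \<beta> 0 * (\<delta> i k * \<delta> m j + \<delta> j k * \<delta> m i)" for m k i j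
  have pchr: "partial m (christoffel h k i j) 0 = (DD m i j k + DD m j i k - DD m k i j) / (2 * \<alpha> 0)" for m k i j
  proof -
    have "((\<lambda>y. (\<Sum>l\<in>UNIV. matrix_inv (h y) $ k $ l * (Dh i j l y + Dh j i l y - Dh l i j y)) / 2) has_derivative
       (\<lambda>d. (\<Sum>l\<in>UNIV. matrix_inv (h 0) $ k $ l *
          (2 * \<alpha>' 0 * \<delta> j l * d $ i + \<beta> 0 * (\<delta> j i * d $ l + \<delta> l i * d $ j)
          + (2 * \<alpha>' 0 * \<delta> i l * d $ j + \<beta> 0 * (\<delta> i j * d $ l + \<delta> l j * d $ i))
          - (2 * \<alpha>' 0 * \<delta> i j * d $ l + \<beta> 0 * (\<delta> i l * d $ j + \<delta> j l * d $ i)))) / 2)) (at 0)"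
      by (intro bounded_linear.has_derivative[OF bounded_linear_divide] has_derivative_sum has_derivative_mult_isCont coninv
          has_derivative_add[OF dDh dDh, THEN has_derivative_diff, OF dDh]) (simp_all add: Dh0)
    then have "(christoffel h k i j has_derivative
       (\<lambda>d. (\<Sum>l\<in>UNIV. matrix_inv (h 0) $ k $ l *
          (2 * \<alpha>' 0 * \<delta> j l * d $ i + \<beta> 0 * (\<delta> j i * d $ l + \<delta> l i * d $ j)
          + (2 * \<alpha>' 0 * \<delta> i l * d $ j + \<beta> 0 * (\<delta> i j * d $ l + \<delta> l j * d $ i))
          - (2 * \<alpha>' 0 * \<delta> i j * d $ l + \<beta> 0 * (\<delta> i l * d $ j + \<delta> j l * d $ i)))) / 2)) (at 0)"
      by (rule has_derivative_transform_within_open[OF _ S]) (simp add: chr)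
    then have "partial m (christoffel h k i j) 0
      = (\<Sum>l\<in>UNIV. \<delta> k l / \<alpha> 0 * (DD m i j l + DD m j i l - DD m l i j)) / 2"
      by (simp add: partial_eq DD_def \<delta>_def[symmetric] inv0)
    also have "\<dots> = (DD m i j k + DD m j i k - DD m k i j) / (2 * \<alpha> 0)"
      using 0 exhaust_2[of k] by (auto simp: sum_2 \<delta> field_simps)
    finally show ?thesis .
  qed
  \<comment> \<open>This component suffices: \<open>h 0\<close> is diagonal, so the other summand in
    the curvature vanishes.\<close>
  have "riemann h 1 2 1 2 0 = (\<beta> 0 - 2 * \<alpha>' 0) / \<alpha> 0"
    unfolding riemann_def pchr using 0 by (simp add: chr0 DD_def \<delta> field_simps)
  then show ?thesis
    unfolding coord_gauss_curvature_def sum_2 h0 det0 using 0 by (simp add: \<delta> power2_eq_square)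
qed

text \<open>The derivative of p/q, named as a function so that its own continuity can be
  stated.\<close>

definition quotient_deriv :: "real poly \<Rightarrow> real poly \<Rightarrow> real \<Rightarrow> real" where
  "quotient_deriv p q z = (poly (pderiv p) z * poly q z - poly p z * poly (pderiv q) z) / (poly q z * poly q z)"

lemma DERIV_quotient_poly:
  "poly q z \<noteq> 0 \<Longrightarrow> ((\<lambda>z. poly p z / poly q z) has_real_derivative quotient_deriv p q z) (at z)"
  unfolding quotient_deriv_def by (intro DERIV_divide poly_DERIV)

lemma isCont_quotient_deriv: "poly q z \<noteq> 0 \<Longrightarrow> isCont (quotient_deriv p q) z"
  unfolding quotient_deriv_def by (auto intro!: continuous_intros)

context unit_density_profile
begin

text \<open>The pole conditions give \<alpha>(0) = 4, \<alpha>'(0) = -8 and \<beta>(0) = 0, the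
  values of the round metric.\<close>

lemma gauss_curvature_pole:
  assumes e: "\<epsilon> \<in> {1, -1}" and T: "open T" "\<epsilon> \<in> T"
    and \<psi>: "\<And>z. z \<in> T \<Longrightarrow> (\<psi> has_real_derivative \<psi>' z) (at z)"
    and \<kappa>: "\<And>z. z \<in> T \<Longrightarrow> (\<kappa> has_real_derivative \<kappa>' z) (at z)"
    and c: "isCont \<psi>' \<epsilon>" "isCont \<kappa>' \<epsilon>"
    and pole: "\<psi> \<epsilon> = 1" "\<psi>' \<epsilon> = 0" "\<kappa> \<epsilon> = 0"
  shows "coord_gauss_curvature (pullback (profile_metric \<psi> \<kappa>) \<epsilon>) 0 = 1"
proof -
  \<comment> \<open>The height as a function of r = |x|^2. It is used for all r > -1, because
    derivatives at r = 0 are two-sided.\<close>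
  define \<zeta> where "\<zeta> r = \<epsilon> * (1 - r) / (1 + r)" for r :: real
  define \<zeta>' where "\<zeta>' r = - 2 * \<epsilon> / (1 + r)\<^sup>2" for r :: real
  define \<alpha> where "\<alpha> r = 4 * \<psi> (\<zeta> r) / (1 + r)\<^sup>2" for r
  define \<beta> where "\<beta> r = 16 * \<kappa> (\<zeta> r) / (1 + r) ^ 4" for r
  define \<alpha>' where "\<alpha>' r = (4 * (\<psi>' (\<zeta> r) * \<zeta>' r) * (1 + r)\<^sup>2 - 4 * \<psi> (\<zeta> r) * (2 * (1 + r))) / ((1 + r)\<^sup>2 * (1 + r)\<^sup>2)" for r
  define \<beta>' where "\<beta>' r = (16 * (\<kappa>' (\<zeta> r) * \<zeta>' r) * (1 + r) ^ 4 - 16 * \<kappa> (\<zeta> r) * (4 * (1 + r) ^ 3)) / ((1 + r) ^ 4 * (1 + r) ^ 4)" for r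
  have d\<zeta>: "(\<zeta> has_real_derivative \<zeta>' r) (at r)" if "r > -1" for r
  proof -
    have "(\<zeta> has_real_derivative (\<epsilon> * (0 - 1) * (1 + r) - \<epsilon> * (1 - r) * 1) / ((1 + r) * (1 + r))) (at r)"
      unfolding \<zeta>_def using that by (auto intro!: derivative_eq_intros)
    moreover have "\<epsilon> * (0 - 1) * (1 + r) - \<epsilon> * (1 - r) * 1 = - 2 * \<epsilon>" by (simp add: algebra_simps)
    ultimately show ?thesis by (simp add: \<zeta>'_def power2_eq_square)
  qed
  define T' where "T' = {-1<..} \<inter> \<zeta> -` T"
  have cz: "continuous_on {-1<..} \<zeta>"
    using d\<zeta> by (intro continuous_at_imp_continuous_on) (auto intro: DERIV_isCont)
  have T': "open T'" "0 \<in> T'"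
    unfolding T'_def using continuous_open_preimage[OF cz _ T(1)] T(2) by (auto simp: \<zeta>_def)
  have "coord_gauss_curvature (pullback (profile_metric \<psi> \<kappa>) \<epsilon>) 0 = (\<beta> 0 - 2 * \<alpha>' 0) / (\<alpha> 0)\<^sup>2"
  proof (rule coord_gauss_curvature_origin[OF _ T'])
    show "pullback (profile_metric \<psi> \<kappa>) \<epsilon> y $ i $ j
        = \<alpha> ((norm y)\<^sup>2) * axis i 1 $ j + \<beta> ((norm y)\<^sup>2) * (y $ i * y $ j)" for y i j
      unfolding pullback_profile_metric[OF e] \<alpha>_def \<beta>_def \<zeta>_def height_def ..
    fix r assume "r \<in> T'"
    then have r: "r > -1" "\<zeta> r \<in> T" by (auto simp: T'_def)
    have n: "(1 + r) ^ k \<noteq> 0" for k using r by simp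
    have p: "((\<lambda>r. (1 + r) ^ k) has_real_derivative k * (1 + r) ^ (k - 1)) (at r)" for k
      by (auto intro!: derivative_eq_intros)
    note chain = DERIV_chain2[OF \<psi>[OF r(2)] d\<zeta>[OF r(1)]] DERIV_chain2[OF \<kappa>[OF r(2)] d\<zeta>[OF r(1)]]
    show "(\<alpha> has_real_derivative \<alpha>' r) (at r)"
      using DERIV_divide[OF DERIV_cmult[OF chain(1), of 4] p[of 2] n[of 2]]
      unfolding \<alpha>_def \<alpha>'_def by simp
    show "(\<beta> has_real_derivative \<beta>' r) (at r)"
      using DERIV_divide[OF DERIV_cmult[OF chain(2), of 16] p[of 4] n[of 4]]
      unfolding \<beta>_def \<beta>'_def by simp
  next
    have \<zeta>0: "isCont \<zeta> 0" "\<zeta> 0 = \<epsilon>" using d\<zeta>[of 0] by (auto intro: DERIV_isCont simp: \<zeta>_def)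
    have comp: "isCont (\<lambda>r. f (\<zeta> r)) 0" if "isCont f \<epsilon>" for f :: "real \<Rightarrow> real"
      using isCont_o2[OF \<zeta>0(1), of f] that \<zeta>0(2) by simp
    have c': "isCont \<psi> \<epsilon>" "isCont \<kappa> \<epsilon>" using \<psi> \<kappa> T(2) by (auto intro: DERIV_isCont)
    have "isCont \<zeta>' 0" unfolding \<zeta>'_def by (intro continuous_intros) auto
    then show "isCont \<alpha>' 0" "isCont \<beta>' 0"
      unfolding \<alpha>'_def \<beta>'_def by (intro continuous_intros comp c c'; simp)+
    show "\<alpha> 0 \<noteq> 0" using pole by (simp add: \<alpha>_def \<zeta>_def)
  qed
  also have "\<dots> = 1" using pole by (simp add: \<alpha>_def \<beta>_def \<alpha>'_def \<zeta>_def)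
  finally show ?thesis .
qed

end

section \<open>The invariant spectrum\<close>

context eigen_profile
begin

abbreviation "\<psi> \<equiv> \<lambda>z. poly G z / poly Q z"
text \<open>Unit density asks for \<kappa> (1 - z^2) = 1/\<psi> - \<psi> = (Q - G)(Q + G) / (Q G).
  Since Q - G = (1 - z^2) H, the factor 1 - z^2 cancels and \<kappa> stays regular at the
  poles.\<close>

abbreviation "\<kappa> \<equiv> \<lambda>z. poly (H * (Q + G)) z / poly (Q * G) z"
abbreviation "g \<equiv> profile_metric \<psi> \<kappa>"

lemma Q_minus_G: "poly Q z - poly G z = (1 - z\<^sup>2) * poly H z"
  using arg_cong[OF Q_eq, of "\<lambda>p. poly p z"] by (simp add: algebra_simps power2_eq_square)

sublocale unit_density_profile \<psi> \<kappa>
proof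
  fix z :: real assume z: "\<bar>z\<bar> \<le> 1"
  note pos = Q_pos[OF z] G_pos[OF z]
  then show "\<psi> z > 0" by simp
  have "\<kappa> z * (1 - z\<^sup>2) = ((1 - z\<^sup>2) * poly H z) * (poly Q z + poly G z) / (poly Q z * poly G z)"
    by simp
  also have "\<dots> = (poly Q z - poly G z) * (poly Q z + poly G z) / (poly Q z * poly G z)"
    unfolding Q_minus_G ..
  also have "\<dots> = poly Q z / poly G z - \<psi> z"
    using pos by (simp add: field_simps)
  finally show "\<psi> z * (\<psi> z + \<kappa> z * (1 - z\<^sup>2)) = 1" using pos by simp
qed

lemma invariant_metric: "S1_invariant_metric g"
proof (rule S1_invariant_profile_metric)
  fix \<epsilon> :: real assume e: "\<epsilon> \<in> {1, -1}"
  have "poly Q (height \<epsilon> x) \<noteq> 0" "poly (Q * G) (height \<epsilon> x) \<noteq> 0" for x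
    using Q_pos G_pos abs_height_le[OF e, of x] by (simp_all add: less_imp_neq[symmetric])
  then show "smooth (\<lambda>x. \<psi> (height \<epsilon> x))" "smooth (\<lambda>x. \<kappa> (height \<epsilon> x))"
    by (intro smooth_intros smooth_height; simp)+
qed

text \<open>The zeros of \<open>H\<close> give \<kappa> = 0 at the poles. Differentiating Q = G + (1
  - z^2) H there gives Q' = G', hence \<psi>' = 0.\<close>

lemma curvature_poles: "gauss_curvature g north = 1" "gauss_curvature g south = 1"
proof -
  have "coord_gauss_curvature (pullback g \<epsilon>) 0 = 1" if e: "\<epsilon> \<in> {1, -1}" for \<epsilon>
  proof -
    have \<epsilon>: "\<bar>\<epsilon>\<bar> \<le> 1" "\<epsilon>\<^sup>2 = 1" "poly H \<epsilon> = 0" using e H_poles by auto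
    have nz: "poly Q \<epsilon> \<noteq> 0" "poly G \<epsilon> \<noteq> 0" "poly (Q * G) \<epsilon> \<noteq> 0"
      using Q_pos[OF \<epsilon>(1)] G_pos[OF \<epsilon>(1)] by simp_all
    have QG: "poly Q \<epsilon> = poly G \<epsilon>" using Q_minus_G[of \<epsilon>] \<epsilon> by simp
    have "pderiv [:1, 0, - 1:] = [:0, - 2 :: real:]" by (simp add: pderiv_pCons)
    then have "poly (pderiv Q) \<epsilon> = poly (pderiv G) \<epsilon>"
      unfolding Q_eq pderiv_add pderiv_mult using \<epsilon> by (simp add: power2_eq_square)
    then have "quotient_deriv G Q \<epsilon> = 0" by (simp add: quotient_deriv_def QG)
    moreover have "open {z. poly (Q * G) z \<noteq> 0}" by (intro open_Collect_neq continuous_intros)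
    ultimately show ?thesis
      using nz \<epsilon> QG
      by (intro gauss_curvature_pole[OF e, of "{z. poly (Q * G) z \<noteq> 0}" "quotient_deriv G Q"
            "quotient_deriv (H * (Q + G)) (Q * G)"] DERIV_quotient_poly isCont_quotient_deriv) auto
  qed
  moreover have "chart 1 north = 0" "chart (-1) south = 0"
    by (simp_all add: chart_def north_def south_def vec_eq_iff forall_2)
  ultimately show "gauss_curvature g north = 1" "gauss_curvature g south = 1"
    by (simp_all add: gauss_curvature_def hemisphere_def Let_def)
      (simp_all add: north_def south_def)
qed

lemma zero_in_spectrum: "0 \<in> invariant_spectrum g"
proof -
  have "laplacian g (\<lambda>_. 1) p = 0" if "p \<in> S2" for p
    using laplacian_height_function[OF that, of UNIV "\<lambda>_. 1" "\<lambda>_. 0" 0 "\<lambda>_. 1"] by simp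
  moreover have "north \<in> S2" by (simp add: north_def norm_eq_sqrt_inner inner_3)
  ultimately show ?thesis
    unfolding invariant_spectrum_def
    by (auto simp: smooth_on_S2_def S1_invariant_fun_def smooth_const intro!: exI[of _ "\<lambda>_. 1"])
qed

text \<open>The eigenfunction is \<open>U\<close> of the height: \<psi> U' = G, so its flux is (1 -
  z^2) G, with derivative -c U.\<close>

lemma c_in_spectrum: "c \<in> invariant_spectrum g"
proof -
  define f where "f p = poly U (p $ 3)" for p :: "real^3"
  have "laplacian g f p = c * f p" if p: "p \<in> S2" for p
  proof -
    define z where "z = p $ 3"
    have "\<bar>z\<bar> \<le> 1" using component_le_norm_cart[of p 3] p by (simp add: z_def)
    then have Qz: "poly Q z \<noteq> 0" using Q_pos[of z] by simp
    have op: "open {z. poly Q z \<noteq> 0}" by (intro open_Collect_neq continuous_intros)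
    have "((\<lambda>t. \<psi> t * poly Q t) has_real_derivative poly (pderiv G) z) (at z)"
      by (rule has_field_derivative_transform_within_open[OF poly_DERIV op]) (use Qz in auto)
    then have "laplacian g f p = 2 * z * (\<psi> z * poly Q z) - (1 - z\<^sup>2) * poly (pderiv G) z"
      unfolding z_def
      by (intro laplacian_height_function[OF p, of UNIV "poly U"])
        (auto simp: f_def simp flip: pderiv_U intro: poly_DERIV)
    also have "\<dots> = - poly (pderiv ([:1, 0, -1:] * G)) z"
    proof -
      have "pderiv [:1, 0, - 1:] = [:0, - 2 :: real:]" by (simp add: pderiv_pCons)
      then show ?thesis unfolding pderiv_mult using Qz by (simp add: algebra_simps power2_eq_square)
    qed
    also have "\<dots> = c * f p" unfolding pderiv_flux by (simp add: f_def z_def)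
    finally show ?thesis .
  qed
  moreover have "smooth_on_S2 f"
    unfolding smooth_on_S2_def f_def stereo_nth by (auto intro!: smooth_poly smooth_height)
  moreover have "S1_invariant_fun f" by (simp add: S1_invariant_fun_def f_def rotate_def)
  \<comment> \<open>\<open>U\<close> is strictly increasing, so it cannot vanish at both
    poles.\<close>
  moreover have "\<exists>p\<in>S2. f p \<noteq> 0"
  proof -
    obtain x where x: "-1 < x" "x < 1" "poly U 1 - poly U (-1) = 2 * poly Q x"
      using poly_MVT[of "-1" 1 U] by (auto simp: pderiv_U)
    then have "poly U 1 \<noteq> 0 \<or> poly U (-1) \<noteq> 0" using Q_pos[of x] by (auto simp: abs_le_iff)
    then have "f north \<noteq> 0 \<or> f south \<noteq> 0" by (simp add: f_def north_def south_def)
    moreover have "north \<in> S2" "south \<in> S2" by (simp_all add: north_def south_def norm_eq_sqrt_inner inner_3)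
    ultimately show ?thesis by blast
  qed
  ultimately show ?thesis unfolding invariant_spectrum_def by blast
qed

text \<open>The gap lemma makes the profile of an eigenfunction constant; its flux is then zero, so
  \<nu> times a nonzero constant is 0.\<close>

lemma spectrum_below_c:
  assumes "\<nu> \<in> invariant_spectrum g" "\<nu> < c"
  shows "\<nu> = 0"
proof -
  obtain f where f: "smooth_on_S2 f" "S1_invariant_fun f" "\<exists>p\<in>S2. f p \<noteq> 0"
    and eig: "\<And>p. p \<in> S2 \<Longrightarrow> laplacian g f p = \<nu> * f p"
    using assms(1) unfolding invariant_spectrum_def by blast
  obtain W W' W'' B where W: "\<And>p. p \<in> S2 \<Longrightarrow> f p = W (p $ 3)"
    "\<And>z. \<bar>z\<bar> < 1 \<Longrightarrow> (W has_real_derivative W' z) (at z)"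
    "\<And>z. \<bar>z\<bar> < 1 \<Longrightarrow> (W' has_real_derivative W'' z) (at z)"
    "((\<lambda>z. (1 - z\<^sup>2) * (W' z)\<^sup>2) \<longlongrightarrow> 0) (at_right (-1))"
    "((\<lambda>z. (1 - z\<^sup>2) * (W' z)\<^sup>2) \<longlongrightarrow> 0) (at_left 1)"
    "\<And>z. \<bar>z\<bar> < 1 \<Longrightarrow> \<bar>W z\<bar> \<le> B"
    using S1_invariant_fun_profile[OF f(2,1)] by blast
  have op: "open {z::real. \<bar>z\<bar> < 1}" by (intro open_Collect_less continuous_intros)
  \<comment> \<open>The eigenvalue equation at the meridian point of height z, regrouped into
    divergence form.\<close>
  have ode: "((\<lambda>z. (1 - z\<^sup>2) * (\<psi> z * W' z)) has_real_derivative - \<nu> * W z) (at z)" if z: "\<bar>z\<bar> < 1" for z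
  proof -
    define p :: "real^3" where "p = vector [sqrt (1 - z\<^sup>2), 0, z]"
    have p: "p \<in> S2" "p $ 3 = z" using meridian_in_S2[of z] z by (simp_all add: p_def)
    have "poly Q z \<noteq> 0" using Q_pos[of z] z by simp
    then have "\<exists>D. (\<psi> has_real_derivative D) (at z)" by (blast intro: DERIV_divide poly_DERIV)
    then obtain M' where M': "((\<lambda>t. \<psi> t * W' t) has_real_derivative M') (at z)"
      using DERIV_mult[OF _ W(3)[OF z]] by blast
    have "laplacian g f p = 2 * z * (\<psi> z * W' z) - (1 - z\<^sup>2) * M'"
      using laplacian_height_function[OF p(1), of "{z. \<bar>z\<bar> < 1}" W W' M' f] W(1,2) M' op z p(2) by simp
    then have "- 2 * z * (\<psi> z * W' z) + M' * (1 - z\<^sup>2) = - \<nu> * W z"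
      using eig[OF p(1)] W(1)[OF p(1)] p(2) by (simp add: mult.commute)
    moreover have "((\<lambda>z. 1 - z\<^sup>2) has_real_derivative - 2 * z) (at z)"
      by (auto intro!: derivative_eq_intros)
    from DERIV_mult[OF this M']
    have "((\<lambda>z. (1 - z\<^sup>2) * (\<psi> z * W' z)) has_real_derivative
      - 2 * z * (\<psi> z * W' z) + M' * (1 - z\<^sup>2)) (at z)" .
    ultimately show ?thesis by (simp only:)
  qed
  have W'0: "W' z = 0" if "\<bar>z\<bar> < 1" for z
    using no_small_eigenvalue[OF W(2) ode W(4,5,6) assms(2) that] .
  have const: "W z = W 0" if "\<bar>z\<bar> < 1" for z
  proof -
    have "\<exists>k. \<forall>x\<in>{-1<..<1}. W x = k"
      using W(2) W'0 by (intro has_field_derivative_zero_constant)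
        (auto intro: has_field_derivative_at_within)
    then show ?thesis using that by (force simp: abs_less_iff)
  qed
  \<comment> \<open>Otherwise \<open>f\<close> vanishes off the poles, and by continuity in the
    charts at the poles too, contradicting that it is nonzero somewhere.\<close>
  have "W 0 \<noteq> 0"
  proof
    assume W0: "W 0 = 0"
    have pole: "f (stereo \<epsilon> 0) = 0" if e: "\<epsilon> \<in> {1, -1}" for \<epsilon>
    proof (rule LIM_unique)
      have "isCont (\<lambda>x. f (stereo \<epsilon> x)) 0"
        using f(1) e unfolding smooth_on_S2_def by (blast intro: smooth_isCont)
      then show "(\<lambda>x. f (stereo \<epsilon> x)) \<midarrow>0\<rightarrow> f (stereo \<epsilon> 0)" by (simp add: isCont_def)
      have "f (stereo \<epsilon> x) = 0" if "x \<noteq> 0" for x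
      proof -
        have "1 - (height \<epsilon> x)\<^sup>2 > 0"
          unfolding one_minus_height_sq[OF e] using that one_plus_norm_sq_pos[of x] by simp
        then have "\<bar>height \<epsilon> x\<bar> < 1" by (simp flip: abs_square_less_1)
        then show ?thesis using W(1)[OF stereo_in_S2[OF e]] const W0 by (simp add: stereo_nth)
      qed
      then show "(\<lambda>x. f (stereo \<epsilon> x)) \<midarrow>0\<rightarrow> 0"
        by (intro tendsto_eventually) (auto simp: eventually_at intro!: exI[of _ 1])
    qed
    obtain p where p: "p \<in> S2" "f p \<noteq> 0" using f(3) by blast
    then have "\<not> \<bar>p $ 3\<bar> < 1" using const[of "p $ 3"] W(1) W0 by auto
    moreover have p1: "(p $ 1)\<^sup>2 + (p $ 2)\<^sup>2 + (p $ 3)\<^sup>2 = 1" using p(1) norm3_sq[of p] by simp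
    moreover have "\<bar>p $ 3\<bar> \<le> 1" using component_le_norm_cart[of p 3] p(1) by simp
    ultimately have p3: "\<bar>p $ 3\<bar> = 1" by linarith
    then have "(p $ 3)\<^sup>2 = 1" by (simp add: abs_square_eq_1)
    with p1 have "p $ 1 = 0" "p $ 2 = 0" by (simp_all add: sum_power2_eq_zero_iff)
    then have "p = stereo (p $ 3) 0" by (simp add: vec_eq_iff forall_3 stereo_nth height_def)
    then show False using p(2) pole[of "p $ 3"] p3 by (metis abs_eq_iff' abs_one insertI1 insertI2)
  qed
  moreover have "((\<lambda>z. (1 - z\<^sup>2) * (\<psi> z * W' z)) has_real_derivative 0) (at 0)"
    by (rule has_field_derivative_transform_within_open[OF DERIV_const op]) (use W'0 in auto)
  then have "\<nu> * W 0 = 0" using DERIV_unique ode[of 0] by fastforce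
  ultimately show ?thesis by simp
qed

lemma first_eigenvalue:
  assumes "c > 0"
  shows "invariant_eigenvalue g 1 c"
proof -
  have "{\<nu> \<in> invariant_spectrum g. \<nu> < c} = {0}"
    using zero_in_spectrum spectrum_below_c assms by auto
  then show ?thesis unfolding invariant_eigenvalue_def using c_in_spectrum by simp
qed

end

theorem theorem1:
  shows "(\<forall>c::real. c > 0 \<longrightarrow>
            (\<exists>g. S1_invariant_metric g \<and> has_area g (4 * pi) \<and> invariant_eigenvalue g 1 c)) \<and>
         (\<forall>c::real. c > 0 \<longrightarrow>
            (\<exists>g. S1_invariant_metric g \<and> has_area g (4 * pi) \<and>
                 gauss_curvature g north = 1 \<and> gauss_curvature g south = 1 \<and>
                 invariant_eigenvalue g 1 c))"
proof -
  \<comment> \<open>The metric with prescribed pole curvature serves for both conjuncts.\<close>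
  have "\<exists>g. S1_invariant_metric g \<and> has_area g (4 * pi) \<and>
      gauss_curvature g north = 1 \<and> gauss_curvature g south = 1 \<and> invariant_eigenvalue g 1 c"
    if c: "c > 0" for c :: real
  proof -
    obtain Q G H U where "eigen_profile Q G H U c"
      using eigenfunction_polynomials[OF c] unfolding eigen_profile_def by metis
    then interpret eigen_profile Q G H U c .
    show ?thesis
      using invariant_metric has_area_profile_metric curvature_poles first_eigenvalue[OF c] by blast
  qed
  then show ?thesis by blast
qed

end
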